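(* Let $\mu\in\mathbb R$ and $\sigma>0$. Define $U(x):=(x-a)_+$ for a threshold $a\in\mathbb R$ and $w_{\alpha,\beta}(u):=\mathbf 1_{(\alpha,\beta]}(u)/(\beta-\alpha)$ for two confidence levels $0\le\alpha<\beta\le1$, and let $$\Psi(q):=\int_0^1 w_{\alpha,\beta}(u)\,U(q(u))\,\mathrm du .$$ Let $\Psi_{\min}$ and $\Psi_{\max}$ denote the optimal values of minimizing and maximizing $\Psi$ over $\mathsf K\cap\mathsf M$, with associated optimal quantiles $q^*_{\min}$ and $q^*_{\max}$. For any $\nu\in(0,1)$, let $$L_\nu:=\mu-\sigma\sqrt{\frac{1-\nu}{\nu}},\qquad U_\nu:=\mu+\sigma\sqrt{\frac{\nu}{1-\nu}}.$$ Then the following conclusions hold. (a) $\Psi_{\min}=\max\{L_\beta-a,0\}$, which is attained by the two-level quantile $q^*_{\min}(u)=L_\beta\,\mathbf 1_{\{u\le\beta\}}+U_\beta\,\mathbf 1_{\{u>\beta\}}$. (b) Define $T_{\alpha,\beta}:=\mu+\sigma\,\dfrac{-2\alpha^2+3\alpha-\beta}{2(1-\alpha)\sqrt{\alpha(1-\alpha)}}$, which satisfies $T_{\alpha,\beta}\le U_\alpha<U_\beta$. For $T_{\alpha,\beta}<a<U_\beta$, let $t^*_{\alpha,\beta}$ be the unique positive root of $$(1-\beta)\,t^4+(3-2\beta)\,t^2+\frac{2(\mu-a)}{\sigma}\,t-\beta=0,$$ and set $p^*:=(t^*_{\alpha,\beta})^2/(1+(t^*_{\alpha,\beta})^2)$.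 Then $\Psi_{\max}$ admits the closed-form solution $$\Psi_{\max}=\begin{cases}U_\alpha-a,& a\le T_{\alpha,\beta},\\[2pt] \dfrac{\beta-p^*}{\beta-\alpha}\bigl(\mu-a+\sigma t^*_{\alpha,\beta}\bigr),& T_{\alpha,\beta}<a<U_\beta,\\[2pt] 0,& a\ge U_\beta.\end{cases}$$ Moreover, the associated maximizers take the following forms, for $u\in[0,1]$: $$q^*_{\max}(u)=\begin{cases}L_\alpha\mathbf 1_{\{u\le\alpha\}}+U_\alpha\mathbf 1_{\{u>\alpha\}},& a\le T_{\alpha,\beta},\\ L_{p^*}\mathbf 1_{\{0\le u\le p^*\}}+U_{p^*}\mathbf 1_{\{p^*<u\le1\}},& T_{\alpha,\beta}<a<U_\beta,\\ q^*_{\min}(u),& a\ge U_\beta.\end{cases}$$ (c) When $\alpha=0$ and $\beta=1$, $w_{\alpha,\beta}(u)=1$ for all $u\in[0,1]$, which exactly corresponds to the expectation. In this case $\lim_{\alpha\downarrow0,\,\beta\uparrow1}T_{\alpha,\beta}=-\infty$ and $\lim_{\beta\uparrow1}U_\beta=+\infty$, and the quartic equation in (b) reduces to a quadratic one with $$t^*_{0,1}=\frac{\sqrt{(\mu-a)^2+\sigma^2}-(\mu-a)}{\sigma},$$ which further yields $$\sup_{q\in\mathsf K\cap\mathsf M}\Psi(q)=\frac12\Bigl(\sqrt{(a-\mu)^2+\sigma^2}-(a-\mu)\Bigr).$$ Moreover, the maximizer takes the two-point form with values $a\pm\sqrt{(\mu-a)^2+\sigma^2}$, recovering the classical Scarf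 bound.
   Context: $\mathsf K:=\{q\in L^2(0,1): q\text{ admits an a.e. nondecreasing representative on }(0,1)\}$; $\mathsf M:=\{q\in L^2(0,1):\int_0^1 q\,\mathrm du=\mu,\ \int_0^1 q^2\,\mathrm du=\mu^2+\sigma^2\}$. $(x)_+:=\max\{x,0\}$. Functions $q\in\mathsf K\cap\mathsf M$ play the role of quantile functions of random variables with mean $\mu$ and variance $\sigma^2$. The weight $w_{\alpha,\beta}$ is the density of the range value-at-risk (RVaR) distortion.
   Formalization: In (a), attainment is claimed only for β<1 (at β=1 U_β is undefined and the constant μ is not in M; the value uses L_1=μ); in (c), w_{0,1}(u)=1 is claimed on (0,1], since w_{0,1}(0)=0; in (b), T_{0,β}=−∞, U_0=μ and U_1=+∞ by convention. *)

theory Defs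
  imports "HOL-Probability.Probability"
begin

abbreviation unit_leb :: "real measure" where
  "unit_leb \<equiv> lebesgue_on {0<..<1}"

(* Elements of L^2(0,1) are represented by functions; all notions below respect
   equality almost everywhere on (0,1), and values outside (0,1) are irrelevant. *)
definition L2_unit :: "(real \<Rightarrow> real) set" where
  "L2_unit = {q \<in> borel_measurable unit_leb. integrable unit_leb (\<lambda>u. (q u)\<^sup>2)}"

definition K_set :: "(real \<Rightarrow> real) set" where
  "K_set = {q \<in> L2_unit. \<exists>r. mono_on {0<..<1} r \<and> (AE u in unit_leb. q u = r u)}"

definition M_set :: "real \<Rightarrow> real \<Rightarrow> (real \<Rightarrow> real) set" where
  "M_set \<mu> \<sigma> = {q \<in> L2_unit.
     (\<integral>u. q u \<partial>unit_leb) = \<mu> \<and> (\<integral>u. (q u)\<^sup>2 \<partial>unit_leb) = \<mu>\<^sup>2 + \<sigma>\<^sup>2}"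

definition rvar_weight :: "real \<Rightarrow> real \<Rightarrow> real \<Rightarrow> real" where
  "rvar_weight \<alpha> \<beta> u = indicator {\<alpha><..\<beta>} u / (\<beta> - \<alpha>)"

definition stop_loss :: "real \<Rightarrow> real \<Rightarrow> real" where
  "stop_loss a x = max (x - a) 0"

definition Psi :: "real \<Rightarrow> real \<Rightarrow> real \<Rightarrow> (real \<Rightarrow> real) \<Rightarrow> real" where
  "Psi a \<alpha> \<beta> q = (\<integral>u. rvar_weight \<alpha> \<beta> u * stop_loss a (q u) \<partial>unit_leb)"

(* Optimal values are taken in the extended reals, so that equality with a real number
   entails that the feasible set is nonempty and the objective is bounded on it. *)
definition Psi_min :: "real \<Rightarrow> real \<Rightarrow> real \<Rightarrow> real \<Rightarrow> real \<Rightarrow> ereal" where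
  "Psi_min \<mu> \<sigma> a \<alpha> \<beta> = (INF q \<in> K_set \<inter> M_set \<mu> \<sigma>. ereal (Psi a \<alpha> \<beta> q))"

definition Psi_max :: "real \<Rightarrow> real \<Rightarrow> real \<Rightarrow> real \<Rightarrow> real \<Rightarrow> ereal" where
  "Psi_max \<mu> \<sigma> a \<alpha> \<beta> = (SUP q \<in> K_set \<inter> M_set \<mu> \<sigma>. ereal (Psi a \<alpha> \<beta> q))"

definition is_minimizer :: "real \<Rightarrow> real \<Rightarrow> real \<Rightarrow> real \<Rightarrow> real \<Rightarrow> (real \<Rightarrow> real) \<Rightarrow> bool" where
  "is_minimizer \<mu> \<sigma> a \<alpha> \<beta> q \<longleftrightarrow>
     q \<in> K_set \<inter> M_set \<mu> \<sigma> \<and> ereal (Psi a \<alpha> \<beta> q) = Psi_min \<mu> \<sigma> a \<alpha> \<beta>"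

definition is_maximizer :: "real \<Rightarrow> real \<Rightarrow> real \<Rightarrow> real \<Rightarrow> real \<Rightarrow> (real \<Rightarrow> real) \<Rightarrow> bool" where
  "is_maximizer \<mu> \<sigma> a \<alpha> \<beta> q \<longleftrightarrow>
     q \<in> K_set \<inter> M_set \<mu> \<sigma> \<and> ereal (Psi a \<alpha> \<beta> q) = Psi_max \<mu> \<sigma> a \<alpha> \<beta>"

definition is_unique_maximizer :: "real \<Rightarrow> real \<Rightarrow> real \<Rightarrow> real \<Rightarrow> real \<Rightarrow> (real \<Rightarrow> real) \<Rightarrow> bool" where
  "is_unique_maximizer \<mu> \<sigma> a \<alpha> \<beta> q \<longleftrightarrow>
     is_maximizer \<mu> \<sigma> a \<alpha> \<beta> q \<and>
     (\<forall>r. is_maximizer \<mu> \<sigma> a \<alpha> \<beta> r \<longrightarrow> (AE u in unit_leb. r u = q u))"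

(* Lo and Up are meant for 0 < nu < 1. The formulas also give the correct limits
   Lo 1 = mu and Up 0 = mu, whereas Lo 0 and Up 1 are junk values (division by zero). *)
definition Lo :: "real \<Rightarrow> real \<Rightarrow> real \<Rightarrow> real" where
  "Lo \<mu> \<sigma> \<nu> = \<mu> - \<sigma> * sqrt ((1 - \<nu>) / \<nu>)"

definition Up :: "real \<Rightarrow> real \<Rightarrow> real \<Rightarrow> real" where
  "Up \<mu> \<sigma> \<nu> = \<mu> + \<sigma> * sqrt (\<nu> / (1 - \<nu>))"

(* Regime boundaries, extended by their limits: +infinity at nu = 1 and
   -infinity at alpha = 0. *)
definition Up_ext :: "real \<Rightarrow> real \<Rightarrow> real \<Rightarrow> ereal" where
  "Up_ext \<mu> \<sigma> \<nu> = (if \<nu> = 1 then \<infinity> else ereal (Up \<mu> \<sigma> \<nu>))"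

definition T_ext :: "real \<Rightarrow> real \<Rightarrow> real \<Rightarrow> real \<Rightarrow> ereal" where
  "T_ext \<mu> \<sigma> \<alpha> \<beta> =
     (if \<alpha> = 0 then - \<infinity>
      else ereal (\<mu> + \<sigma> * ((- 2 * \<alpha>\<^sup>2 + 3 * \<alpha> - \<beta>) / (2 * (1 - \<alpha>) * sqrt (\<alpha> * (1 - \<alpha>))))))"

definition two_point :: "real \<Rightarrow> real \<Rightarrow> real \<Rightarrow> real \<Rightarrow> real" where
  "two_point p l h u = l * indicator {..p} u + h * indicator {p<..} u"

definition two_level :: "real \<Rightarrow> real \<Rightarrow> real \<Rightarrow> real \<Rightarrow> real" where
  "two_level \<mu> \<sigma> \<nu> = two_point \<nu> (Lo \<mu> \<sigma> \<nu>) (Up \<mu> \<sigma> \<nu>)"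

definition quartic :: "real \<Rightarrow> real \<Rightarrow> real \<Rightarrow> real \<Rightarrow> real \<Rightarrow> real" where
  "quartic \<mu> \<sigma> a \<beta> t =
     (1 - \<beta>) * t ^ 4 + (3 - 2 * \<beta>) * t\<^sup>2 + (2 * (\<mu> - a) / \<sigma>) * t - \<beta>"

(* The equation, and hence its root, depends on beta but not on alpha. *)
definition t_star :: "real \<Rightarrow> real \<Rightarrow> real \<Rightarrow> real \<Rightarrow> real" where
  "t_star \<mu> \<sigma> a \<beta> = (THE t. 0 < t \<and> quartic \<mu> \<sigma> a \<beta> t = 0)"

definition p_star :: "real \<Rightarrow> real \<Rightarrow> real \<Rightarrow> real \<Rightarrow> real" where
  "p_star \<mu> \<sigma> a \<beta> = (t_star \<mu> \<sigma> a \<beta>)\<^sup>2 / (1 + (t_star \<mu> \<sigma> a \<beta>)\<^sup>2)"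

(* The distribution with quantile function q, i.e. the law of q(V) for V uniform on (0,1). *)
definition law :: "(real \<Rightarrow> real) \<Rightarrow> real measure" where
  "law q = distr unit_leb borel q"

end

theory Submission
  imports Defs "HOL-Real_Asymp.Real_Asymp"
begin

text \<open>
  Both bounds rest on one identity. For a feasible \<open>q\<close> and the two-level quantile
  \<open>h\<close> that jumps at \<open>\<nu>\<close>, expanding the square and using that \<open>q\<close> and \<open>h\<close> share
  their first two moments gives
  \<open>\<integral> (q - h)\<^sup>2 = 2 (U\<^sub>\<nu> - L\<^sub>\<nu>) ((1 - \<nu>) U\<^sub>\<nu> - \<integral>\<^sub>\<nu>\<^sup>1 q)\<close> (lemma \<open>distance_to_two_level\<close>). So the mean of
  \<open>q\<close> over \<open>(\<nu>, 1)\<close> is at most \<open>U\<^sub>\<nu>\<close>, with equality only for \<open>h\<close>, and the mean over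
  \<open>(0, \<nu>)\<close> is at least \<open>L\<^sub>\<nu>\<close>. Monotonicity of \<open>q\<close> carries these bounds over to
  intervals that stop short of \<open>1\<close> or start above \<open>0\<close>.

  For the minimum, the positive part is convex, so \<open>\<Psi>(q)\<close> is at least the positive part of
  the mean of \<open>q - a\<close> over \<open>(\<alpha>, \<beta>)\<close>, and that mean is at least \<open>L\<^sub>\<beta> - a\<close>. The
  quantile with the jump at \<open>\<beta>\<close> is constant on \<open>(\<alpha>, \<beta>]\<close> and attains the bound; for
  \<open>\<beta> = 1\<close> the infimum is approached by letting the jump tend to \<open>1\<close>.

  For the maximum, a nondecreasing \<open>q\<close> crosses the level \<open>a\<close> at some \<open>p\<close> in
  \<open>[\<alpha>, \<beta>]\<close>, whence \<open>(\<beta> - \<alpha>) \<Psi>(q) = \<integral>\<^sub>p\<^sup>\<beta> (q - a) \<le> (\<beta> - p) (U\<^sub>p - a)\<close>. The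
  problem is now one-dimensional: maximise the tail gain \<open>(\<beta> - p) (U\<^sub>p - a)\<close>. In the variable
  \<open>t = sqrt (p / (1 - p))\<close> its derivative is a negative multiple of the quartic, and the quartic
  changes sign exactly once on the positive axis, from negative to positive
  (lemma \<open>quartic_sign\<close>). So the tail gain rises up to \<open>p\<^sup>*\<close> and falls afterwards. The three
  regimes say whether \<open>p\<^sup>*\<close> lies at or below \<open>\<alpha>\<close>, strictly between \<open>\<alpha>\<close> and \<open>\<beta>\<close>, or at or
  above \<open>\<beta>\<close>; evaluating the quartic at \<open>\<alpha>\<close> and at \<open>\<beta>\<close> turns this into the comparison of
  \<open>a\<close> with \<open>T\<close> and with \<open>U\<^sub>\<beta>\<close>. In the first two regimes the tail gain has a strict peak on
  \<open>[\<alpha>, \<beta>]\<close>, so that a maximizer must cross \<open>a\<close> there and attain equality in the tail bound, which determines it almost everywhere.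
\<close>

section \<open>Integrals over slices of the unit interval\<close>

lemma borel_measurable_unit_leb:
  fixes f :: "real \<Rightarrow> real"
  assumes "f \<in> borel_measurable borel"
  shows "f \<in> borel_measurable unit_leb"
  using assms by (intro measurable_restrict_space1 measurable_completion) simp

lemma prob_space_unit_leb: "prob_space unit_leb"
  by (rule prob_spaceI) (simp add: emeasure_restrict_space)

lemma integrable_bounded_unit_leb:
  fixes f :: "real \<Rightarrow> real"
  assumes "f \<in> borel_measurable unit_leb" "\<And>u. u \<in> {0<..<1} \<Longrightarrow> \<bar>f u\<bar> \<le> B"
  shows "integrable unit_leb f"
proof -
  interpret prob_space unit_leb by (rule prob_space_unit_leb)
  show ?thesis
    by (rule integrable_const_bound[where B = B]) (use assms in \<open>auto intro!: AE_I2\<close>)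
qed

lemma integrable_if_L2_unit:
  assumes "q \<in> L2_unit"
  shows "integrable unit_leb q"
proof -
  interpret prob_space unit_leb by (rule prob_space_unit_leb)
  show ?thesis
    using assms by (auto simp: L2_unit_def intro: square_integrable_imp_integrable)
qed

text \<open>
  The indicator stands inside the integrand because \<open>{x<..y}\<close> is not a measurable set of \<open>unit_leb\<close>
  when it reaches beyond \<open>(0, 1)\<close>, as it does for \<open>y = 1\<close>.
\<close>

definition slice :: "real \<Rightarrow> real \<Rightarrow> (real \<Rightarrow> real) \<Rightarrow> real" where
  "slice x y q = (\<integral>u. indicator {x<..y} u * q u \<partial>unit_leb)"

lemma integrable_slice [simp]:
  fixes q :: "real \<Rightarrow> real"
  assumes "integrable unit_leb q"
  shows "integrable unit_leb (\<lambda>u. indicator {x<..y} u * q u)"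
proof (rule Bochner_Integration.integrable_bound[OF assms])
  have "(indicator {x<..y} :: real \<Rightarrow> real) \<in> borel_measurable unit_leb"
    by (rule borel_measurable_unit_leb) simp
  then show "(\<lambda>u. indicator {x<..y} u * q u) \<in> borel_measurable unit_leb"
    using assms by (intro borel_measurable_times) auto
qed (auto simp: indicator_def)

lemma slice_const:
  assumes "0 \<le> x" "x \<le> y" "y \<le> 1"
  shows "slice x y (\<lambda>_. c) = c * (y - x)"
proof -
  have "slice x y (\<lambda>_. c) = (\<integral>u. indicator ({x<..y} \<inter> {0<..<1}) u * c \<partial>lebesgue)"
    unfolding slice_def
    by (subst integral_restrict_space) (auto simp: indicator_inter_arith mult_ac intro!: Bochner_Integration.integral_cong)
  also have "{x<..y} \<inter> {0<..<1} = (if y = 1 then {x<..<y} else {x<..y})"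
    using assms by auto
  finally show ?thesis
    using assms by auto
qed

lemma slice_join:
  assumes "integrable unit_leb q" "x \<le> y" "y \<le> z"
  shows "slice x y q + slice y z q = slice x z q"
proof -
  have "slice x y q + slice y z q
    = (\<integral>u. indicator {x<..y} u * q u + indicator {y<..z} u * q u \<partial>unit_leb)"
    unfolding slice_def using assms by (subst Bochner_Integration.integral_add) auto
  also have "\<dots> = slice x z q"
    unfolding slice_def using assms(2,3)
    by (intro Bochner_Integration.integral_cong) (auto simp: indicator_def)
  finally show ?thesis .
qed

lemma slice_mono:
  assumes "integrable unit_leb f" "integrable unit_leb g"
    and "AE u in unit_leb. x < u \<and> u \<le> y \<longrightarrow> f u \<le> g u"
  shows "slice x y f \<le> slice x y g"
proof -
  have "AE u in unit_leb. indicator {x<..y} u * f u \<le> indicator {x<..y} u * g u"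
    using assms(3) by eventually_elim (auto simp: indicator_def)
  then show ?thesis
    unfolding slice_def using assms(1,2) by (intro integral_mono_AE) auto
qed

lemma slice_cong:
  assumes "\<And>u. x < u \<Longrightarrow> u \<le> y \<Longrightarrow> 0 < u \<Longrightarrow> u < 1 \<Longrightarrow> f u = g u"
  shows "slice x y f = slice x y g"
  unfolding slice_def
  using assms by (intro Bochner_Integration.integral_cong) (auto simp: indicator_def)

lemma slice_diff_const:
  assumes "integrable unit_leb q" "0 \<le> x" "x \<le> y" "y \<le> 1"
  shows "slice x y (\<lambda>u. q u - c) = slice x y q - c * (y - x)"
proof -
  have "integrable unit_leb (\<lambda>_. c)"
    by (rule integrable_bounded_unit_leb[where B = "\<bar>c\<bar>"]) auto
  then have "slice x y (\<lambda>u. q u - c) = slice x y q - slice x y (\<lambda>_. c)"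
    unfolding slice_def right_diff_distrib
    using assms(1) by (intro Bochner_Integration.integral_diff integrable_slice)
  then show ?thesis
    using slice_const assms by simp
qed

lemma slice_unit: "slice 0 1 q = (\<integral>u. q u \<partial>unit_leb)"
  unfolding slice_def by (intro Bochner_Integration.integral_cong) auto

section \<open>Two-level quantiles\<close>

text \<open>
  The substitution that makes the tail gain a rational function: \<open>U\<^sub>p\<close> is affine in this variable, and its
  inverse \<open>t\<^sup>2 / (1 + t\<^sup>2)\<close> is the map from \<open>t\<^sup>*\<close> to \<open>p\<^sup>*\<close>.
\<close>

definition odds_root :: "real \<Rightarrow> real" where
  "odds_root p = sqrt (p / (1 - p))"

lemma odds_root_less:
  assumes "0 \<le> p" "p < r" "r < 1"
  shows "odds_root p < odds_root r"
  unfolding odds_root_def using assms by (simp add: field_simps)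

lemma odds_root_inverse:
  assumes "0 \<le> t"
  shows "odds_root (t\<^sup>2 / (1 + t\<^sup>2)) = t" "0 \<le> t\<^sup>2 / (1 + t\<^sup>2)" "t\<^sup>2 / (1 + t\<^sup>2) < 1"
proof -
  have "1 + t\<^sup>2 > 0" by (smt (verit) zero_le_power2)
  then have "t\<^sup>2 / (1 + t\<^sup>2) / (1 - t\<^sup>2 / (1 + t\<^sup>2)) = t\<^sup>2"
    by (simp add: field_simps)
  then show "odds_root (t\<^sup>2 / (1 + t\<^sup>2)) = t"
    using assms by (simp add: odds_root_def)
  show "0 \<le> t\<^sup>2 / (1 + t\<^sup>2)" "t\<^sup>2 / (1 + t\<^sup>2) < 1"
    using \<open>1 + t\<^sup>2 > 0\<close> by simp_all
qed

lemma odds_root_square: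
  assumes "0 \<le> p" "p < 1"
  shows "p = (odds_root p)\<^sup>2 / (1 + (odds_root p)\<^sup>2)" "0 \<le> odds_root p"
  using assms by (auto simp: odds_root_def field_simps)

lemma Up_odds_root: "Up \<mu> \<sigma> p = \<mu> + \<sigma> * odds_root p"
  by (simp add: Up_def odds_root_def)

lemma Up_less:
  assumes "0 < \<sigma>" "0 \<le> p" "p < r" "r < 1"
  shows "Up \<mu> \<sigma> p < Up \<mu> \<sigma> r"
  using odds_root_less[OF assms(2-4)] assms(1) by (simp add: Up_odds_root)

lemma two_level_values:
  assumes "0 < \<nu>" "\<nu> < 1"
  obtains t where "0 < t" "(1 - \<nu>) * t\<^sup>2 = \<nu>"
    "Lo \<mu> \<sigma> \<nu> = \<mu> - \<sigma> / t" "Up \<mu> \<sigma> \<nu> = \<mu> + \<sigma> * t"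
proof
  show "0 < sqrt (\<nu> / (1 - \<nu>))" "(1 - \<nu>) * (sqrt (\<nu> / (1 - \<nu>)))\<^sup>2 = \<nu>"
    using assms by auto
qed (auto simp: Lo_def Up_def real_sqrt_divide)

lemma two_level_moments:
  assumes "0 < \<nu>" "\<nu> < 1"
  shows "\<nu> * Lo \<mu> \<sigma> \<nu> + (1 - \<nu>) * Up \<mu> \<sigma> \<nu> = \<mu>"
    and "\<nu> * (Lo \<mu> \<sigma> \<nu>)\<^sup>2 + (1 - \<nu>) * (Up \<mu> \<sigma> \<nu>)\<^sup>2 = \<mu>\<^sup>2 + \<sigma>\<^sup>2"
proof -
  obtain t where t: "0 < t" "(1 - \<nu>) * t\<^sup>2 = \<nu>"
    and L: "Lo \<mu> \<sigma> \<nu> = \<mu> - \<sigma> / t" and U: "Up \<mu> \<sigma> \<nu> = \<mu> + \<sigma> * t"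
    using two_level_values[OF assms] by metis
  have nu: "\<nu> / t = (1 - \<nu>) * t" "\<nu> / t\<^sup>2 = 1 - \<nu>"
    using t by (simp_all add: field_simps power2_eq_square)
  have "\<nu> * Lo \<mu> \<sigma> \<nu> + (1 - \<nu>) * Up \<mu> \<sigma> \<nu> = \<mu> - \<sigma> * (\<nu> / t) + \<sigma> * ((1 - \<nu>) * t)"
    unfolding L U by (simp add: algebra_simps)
  then show "\<nu> * Lo \<mu> \<sigma> \<nu> + (1 - \<nu>) * Up \<mu> \<sigma> \<nu> = \<mu>"
    by (simp add: nu)
  have "\<nu> * (Lo \<mu> \<sigma> \<nu>)\<^sup>2 + (1 - \<nu>) * (Up \<mu> \<sigma> \<nu>)\<^sup>2
    = \<mu>\<^sup>2 + 2 * \<mu> * \<sigma> * ((1 - \<nu>) * t - \<nu> / t) + \<sigma>\<^sup>2 * (\<nu> / t\<^sup>2 + (1 - \<nu>) * t\<^sup>2)"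
    unfolding L U by (simp add: algebra_simps power2_eq_square)
  then show "\<nu> * (Lo \<mu> \<sigma> \<nu>)\<^sup>2 + (1 - \<nu>) * (Up \<mu> \<sigma> \<nu>)\<^sup>2 = \<mu>\<^sup>2 + \<sigma>\<^sup>2"
    by (simp add: nu t(2))
qed

lemma Lo_less_Up:
  assumes "0 < \<sigma>" "0 < \<nu>" "\<nu> < 1"
  shows "Lo \<mu> \<sigma> \<nu> < \<mu>" "\<mu> < Up \<mu> \<sigma> \<nu>"
  using assms by (auto simp: Lo_def Up_def)

lemma two_level_apply:
  "u \<le> \<nu> \<Longrightarrow> two_level \<mu> \<sigma> \<nu> u = Lo \<mu> \<sigma> \<nu>"
  "\<nu> < u \<Longrightarrow> two_level \<mu> \<sigma> \<nu> u = Up \<mu> \<sigma> \<nu>"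
  by (auto simp: two_level_def two_point_def)

lemma borel_measurable_two_level [measurable]: "two_level \<mu> \<sigma> \<nu> \<in> borel_measurable borel"
  unfolding two_level_def two_point_def by measurable

lemma slice_two_step:
  assumes "integrable unit_leb f" "0 \<le> x" "x \<le> \<nu>" "\<nu> \<le> y" "y \<le> 1"
    and "\<And>u. u \<le> \<nu> \<Longrightarrow> f u = l" "\<And>u. \<nu> < u \<Longrightarrow> f u = h"
  shows "slice x y f = (\<nu> - x) * l + (y - \<nu>) * h"
proof -
  have "slice x y f = slice x \<nu> f + slice \<nu> y f"
    using slice_join assms by simp
  also have "slice x \<nu> f = slice x \<nu> (\<lambda>_. l)" by (rule slice_cong) (use assms in auto)
  also have "slice \<nu> y f = slice \<nu> y (\<lambda>_. h)" by (rule slice_cong) (use assms in auto)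
  finally show ?thesis
    using assms by (simp add: slice_const mult.commute)
qed

lemma integrable_two_level_comp:
  fixes g :: "real \<Rightarrow> real"
  assumes "g \<in> borel_measurable borel"
  shows "integrable unit_leb (\<lambda>u. g (two_level \<mu> \<sigma> \<nu> u))"
proof (rule integrable_bounded_unit_leb)
  show "(\<lambda>u. g (two_level \<mu> \<sigma> \<nu> u)) \<in> borel_measurable unit_leb"
    using measurable_compose[OF borel_measurable_two_level assms]
    by (rule borel_measurable_unit_leb)
  show "\<bar>g (two_level \<mu> \<sigma> \<nu> u)\<bar> \<le> \<bar>g (Lo \<mu> \<sigma> \<nu>)\<bar> + \<bar>g (Up \<mu> \<sigma> \<nu>)\<bar>" for u
    by (cases "u \<le> \<nu>") (auto simp: two_level_apply)
qed

lemma two_level_feasible: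
  assumes "0 < \<sigma>" "0 < \<nu>" "\<nu> < 1"
  shows "two_level \<mu> \<sigma> \<nu> \<in> K_set \<inter> M_set \<mu> \<sigma>"
proof -
  let ?h = "two_level \<mu> \<sigma> \<nu>"
  have int: "integrable unit_leb ?h" "integrable unit_leb (\<lambda>u. (?h u)\<^sup>2)"
    using integrable_two_level_comp[of "\<lambda>x. x"] integrable_two_level_comp[of "\<lambda>x. x\<^sup>2"] by auto
  have L2: "?h \<in> L2_unit"
    using int by (auto simp: L2_unit_def)
  have "mono_on {0<..<1} ?h"
  proof (rule mono_onI)
    fix r s :: real assume "r \<le> s"
    then show "?h r \<le> ?h s"
      using Lo_less_Up[OF assms, of \<mu>]
      by (cases "r \<le> \<nu>"; cases "s \<le> \<nu>") (auto simp: two_level_apply)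
  qed
  moreover have "slice 0 1 ?h = \<mu>"
    using slice_two_step[OF int(1), of 0 \<nu> 1 "Lo \<mu> \<sigma> \<nu>" "Up \<mu> \<sigma> \<nu>"] assms
      two_level_moments(1)[OF assms(2,3)] by (simp add: two_level_apply)
  moreover have "slice 0 1 (\<lambda>u. (?h u)\<^sup>2) = \<mu>\<^sup>2 + \<sigma>\<^sup>2"
    using slice_two_step[OF int(2), of 0 \<nu> 1 "(Lo \<mu> \<sigma> \<nu>)\<^sup>2" "(Up \<mu> \<sigma> \<nu>)\<^sup>2"] assms
      two_level_moments(2)[OF assms(2,3)] by (simp add: two_level_apply)
  ultimately show ?thesis
    using L2 by (auto simp: K_set_def M_set_def slice_unit)
qed

lemma M_setD:
  assumes "q \<in> M_set \<mu> \<sigma>"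
  shows "integrable unit_leb q" "integrable unit_leb (\<lambda>u. (q u)\<^sup>2)"
    "slice 0 1 q = \<mu>" "slice 0 1 (\<lambda>u. (q u)\<^sup>2) = \<mu>\<^sup>2 + \<sigma>\<^sup>2"
proof -
  show "integrable unit_leb q"
    using assms by (intro integrable_if_L2_unit) (simp add: M_set_def)
qed (use assms in \<open>auto simp: M_set_def L2_unit_def slice_unit\<close>)

section \<open>Tail integrals under a mean and a variance constraint\<close>

text \<open>
  On each side of the jump \<open>h = two_level \<mu> \<sigma> \<nu>\<close> is constant, so the cross term \<open>\<integral> q h\<close> depends
  on \<open>q\<close> only through its mean and its tail integral. Nonnegativity of the left-hand side is a sharp
  bound on the tail integral, and its vanishing characterises the extremal \<open>q\<close>.
\<close>

lemma distance_to_two_level: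
  assumes "0 < \<sigma>" "0 < \<nu>" "\<nu> < 1" and q: "q \<in> M_set \<mu> \<sigma>"
  shows "integrable unit_leb (\<lambda>u. (q u - two_level \<mu> \<sigma> \<nu> u)\<^sup>2)"
    and "(\<integral>u. (q u - two_level \<mu> \<sigma> \<nu> u)\<^sup>2 \<partial>unit_leb)
      = 2 * (Up \<mu> \<sigma> \<nu> - Lo \<mu> \<sigma> \<nu>) * ((1 - \<nu>) * Up \<mu> \<sigma> \<nu> - slice \<nu> 1 q)"
proof -
  let ?h = "two_level \<mu> \<sigma> \<nu>" and ?L = "Lo \<mu> \<sigma> \<nu>" and ?U = "Up \<mu> \<sigma> \<nu>"
  have h: "?h \<in> M_set \<mu> \<sigma>"
    using two_level_feasible[OF assms(1-3)] by auto
  note qD = M_setD[OF q] and hD = M_setD[OF h]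
  let ?e = "\<lambda>u. (q u)\<^sup>2 + (?h u)\<^sup>2 - 2 * ?L * q u - 2 * (?U - ?L) * (indicator {\<nu><..1} u * q u)"
  have eq: "(q u - ?h u)\<^sup>2 = ?e u" if "u \<in> {0<..<1}" for u
    using that
    by (cases "u \<le> \<nu>") (auto simp: two_level_apply indicator_def power2_eq_square algebra_simps)
  have int: "integrable unit_leb ?e"
    using qD hD by (intro Bochner_Integration.integrable_add Bochner_Integration.integrable_diff
      integrable_mult_right integrable_slice)
  then show "integrable unit_leb (\<lambda>u. (q u - ?h u)\<^sup>2)"
    by (rule Bochner_Integration.integrable_cong[THEN iffD1, rotated -1]) (auto simp: eq)
  have "(\<integral>u. (q u - ?h u)\<^sup>2 \<partial>unit_leb) = integral\<^sup>L unit_leb ?e"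
    by (rule Bochner_Integration.integral_cong) (auto simp: eq)
  also have "\<dots> = (\<mu>\<^sup>2 + \<sigma>\<^sup>2) + (\<mu>\<^sup>2 + \<sigma>\<^sup>2) - 2 * ?L * \<mu> - 2 * (?U - ?L) * slice \<nu> 1 q"
    using qD hD by (simp add: slice_unit slice_def[of \<nu>])
  also have "\<dots> = 2 * (?U - ?L) * ((1 - \<nu>) * ?U - slice \<nu> 1 q)"
  proof -
    have "\<nu> * l\<^sup>2 + (1 - \<nu>) * h\<^sup>2 - l * m = (h - l) * ((1 - \<nu>) * h)"
      if "\<nu> * l + (1 - \<nu>) * h = m" for l h m :: real
      unfolding that[symmetric] by (simp add: power2_eq_square algebra_simps)
    from this[OF two_level_moments(1)[OF assms(2,3), of \<mu> \<sigma>]] show ?thesis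
      unfolding two_level_moments(2)[OF assms(2,3)] by (simp add: algebra_simps)
  qed
  finally show "(\<integral>u. (q u - ?h u)\<^sup>2 \<partial>unit_leb)
      = 2 * (?U - ?L) * ((1 - \<nu>) * ?U - slice \<nu> 1 q)" .
qed

text \<open>
  The bound includes \<open>\<nu> = 0\<close>, where it says that the mean is \<open>\<mu>\<close>.
\<close>

lemma upper_tail_le:
  assumes "0 < \<sigma>" "0 \<le> \<nu>" "\<nu> < 1" and q: "q \<in> M_set \<mu> \<sigma>"
  shows "slice \<nu> 1 q \<le> (1 - \<nu>) * Up \<mu> \<sigma> \<nu>"
proof (cases "\<nu> = 0")
  case True
  then show ?thesis using M_setD(3)[OF q] by (simp add: Up_def)
next
  case False
  then have \<nu>: "0 < \<nu>" using assms by simp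
  have "0 \<le> 2 * (Up \<mu> \<sigma> \<nu> - Lo \<mu> \<sigma> \<nu>) * ((1 - \<nu>) * Up \<mu> \<sigma> \<nu> - slice \<nu> 1 q)"
    unfolding distance_to_two_level(2)[OF assms(1) \<nu> assms(3) q, symmetric] by simp
  moreover have "0 < Up \<mu> \<sigma> \<nu> - Lo \<mu> \<sigma> \<nu>"
    using Lo_less_Up[OF assms(1) \<nu> assms(3), of \<mu>] by simp
  ultimately show ?thesis by (simp add: zero_le_mult_iff)
qed

lemma upper_tail_eq_imp_two_level:
  assumes "0 < \<sigma>" "0 < \<nu>" "\<nu> < 1" and q: "q \<in> M_set \<mu> \<sigma>"
    and "slice \<nu> 1 q = (1 - \<nu>) * Up \<mu> \<sigma> \<nu>"
  shows "AE u in unit_leb. q u = two_level \<mu> \<sigma> \<nu> u"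
proof -
  have "(\<integral>u. (q u - two_level \<mu> \<sigma> \<nu> u)\<^sup>2 \<partial>unit_leb) = 0"
    using distance_to_two_level(2)[OF assms(1-4)] assms(5) by simp
  then have "AE u in unit_leb. (q u - two_level \<mu> \<sigma> \<nu> u)\<^sup>2 = 0"
    using distance_to_two_level(1)[OF assms(1-4)] by (subst (asm) integral_nonneg_eq_0_iff_AE) auto
  then show ?thesis by eventually_elim simp
qed

text \<open>
  This is the bound on the upper tail, read off the complementary interval; at \<open>\<nu> = 1\<close> it
  says again that the mean is \<open>\<mu>\<close>.
\<close>

lemma lower_tail_ge:
  assumes "0 < \<sigma>" "0 < \<nu>" "\<nu> \<le> 1" and q: "q \<in> M_set \<mu> \<sigma>"
  shows "\<nu> * Lo \<mu> \<sigma> \<nu> \<le> slice 0 \<nu> q"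
proof (cases "\<nu> = 1")
  case True
  then show ?thesis using M_setD(3)[OF q] by (simp add: Lo_def)
next
  case False
  then show ?thesis
    using upper_tail_le[of \<sigma> \<nu> q \<mu>] two_level_moments(1)[of \<nu> \<mu> \<sigma>] assms
      slice_join[OF M_setD(1)[OF q], of 0 \<nu> 1] M_setD(3)[OF q] by simp
qed

text \<open>
  The value of a monotone representative at the common endpoint separates the two means. The products
  avoid division, so that empty intervals are covered too.
\<close>

lemma slice_averages_mono:
  assumes "q \<in> K_set" "0 \<le> x" "x \<le> y" "y \<le> z" "z \<le> 1"
  shows "(z - y) * slice x y q \<le> (y - x) * slice y z q"
proof -
  consider "x = y" | "y = z" | "0 < y" "y < 1" using assms by linarith
  then show ?thesis
  proof cases
    case 3
    obtain r where r: "mono_on {0<..<1} r" "AE u in unit_leb. q u = r u"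
      using assms(1) by (auto simp: K_set_def)
    have q: "integrable unit_leb q"
      using assms(1) by (auto simp: K_set_def integrable_if_L2_unit)
    have c: "integrable unit_leb (\<lambda>_. r y)"
      by (rule integrable_bounded_unit_leb[where B = "\<bar>r y\<bar>"]) auto
    have ae: "AE u in unit_leb. u \<in> {0<..<1} \<and> q u = r u"
      using r(2) AE_space by eventually_elim auto
    have "slice x y q \<le> slice x y (\<lambda>_. r y)"
      using ae by (intro slice_mono q c, eventually_elim) (use r 3 in \<open>auto simp: mono_on_def\<close>)
    moreover have "slice y z (\<lambda>_. r y) \<le> slice y z q"
      using ae by (intro slice_mono q c, eventually_elim) (use r 3 in \<open>auto simp: mono_on_def\<close>)
    ultimately have "slice x y q \<le> r y * (y - x)" "r y * (z - y) \<le> slice y z q"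
      using assms by (simp_all add: slice_const)
    then have "(z - y) * slice x y q \<le> (z - y) * (r y * (y - x))"
      "(y - x) * (r y * (z - y)) \<le> (y - x) * slice y z q"
      using assms by (auto intro: mult_left_mono)
    then show ?thesis by (simp add: mult_ac)
  qed (auto simp: slice_def)
qed

lemma slice_average_le_upper_tail:
  assumes "q \<in> K_set" "0 \<le> p" "p \<le> \<beta>" "\<beta> \<le> 1"
  shows "(1 - p) * slice p \<beta> q \<le> (\<beta> - p) * slice p 1 q"
proof -
  have q: "integrable unit_leb q"
    using assms(1) by (auto simp: K_set_def integrable_if_L2_unit)
  have "(1 - \<beta>) * slice p \<beta> q \<le> (\<beta> - p) * slice \<beta> 1 q"
    using assms by (intro slice_averages_mono) auto
  then show ?thesis
    unfolding slice_join[OF q \<open>p \<le> \<beta>\<close> \<open>\<beta> \<le> 1\<close>, symmetric] by (simp add: algebra_simps)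
qed

lemma slice_le_Up:
  assumes "0 < \<sigma>" "q \<in> K_set \<inter> M_set \<mu> \<sigma>" "0 \<le> p" "p < 1" "p \<le> \<beta>" "\<beta> \<le> 1"
  shows "slice p \<beta> q \<le> (\<beta> - p) * Up \<mu> \<sigma> p"
proof -
  have "(1 - p) * slice p \<beta> q \<le> (\<beta> - p) * slice p 1 q"
    using assms by (intro slice_average_le_upper_tail) auto
  also have "\<dots> \<le> (\<beta> - p) * ((1 - p) * Up \<mu> \<sigma> p)"
    using assms by (intro mult_left_mono upper_tail_le) auto
  finally show ?thesis
    using assms by (simp add: mult.left_commute)
qed

lemma slice_ge_Lo:
  assumes "0 < \<sigma>" "q \<in> K_set \<inter> M_set \<mu> \<sigma>" "0 \<le> \<alpha>" "\<alpha> < \<beta>" "\<beta> \<le> 1"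
  shows "(\<beta> - \<alpha>) * Lo \<mu> \<sigma> \<beta> \<le> slice \<alpha> \<beta> q"
proof -
  have q: "integrable unit_leb q" using assms M_setD by auto
  have "(\<beta> - \<alpha>) * slice 0 \<alpha> q \<le> (\<alpha> - 0) * slice \<alpha> \<beta> q"
    using assms by (intro slice_averages_mono) auto
  then have "(\<beta> - \<alpha>) * slice 0 \<beta> q \<le> \<beta> * slice \<alpha> \<beta> q"
    unfolding slice_join[OF q \<open>0 \<le> \<alpha>\<close> less_imp_le[OF \<open>\<alpha> < \<beta>\<close>], symmetric]
    by (simp add: algebra_simps)
  moreover have "(\<beta> - \<alpha>) * (\<beta> * Lo \<mu> \<sigma> \<beta>) \<le> (\<beta> - \<alpha>) * slice 0 \<beta> q"
    using assms by (intro mult_left_mono lower_tail_ge) auto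
  ultimately have "\<beta> * ((\<beta> - \<alpha>) * Lo \<mu> \<sigma> \<beta>) \<le> \<beta> * slice \<alpha> \<beta> q"
    by (simp add: mult.left_commute)
  then show ?thesis
    using assms by simp
qed

section \<open>Reduction to one crossing level\<close>

lemma mono_on_threshold:
  fixes r :: "real \<Rightarrow> real"
  assumes "mono_on {0<..<1} r" "0 \<le> \<alpha>" "\<alpha> \<le> \<beta>" "\<beta> \<le> 1"
  obtains p where "\<alpha> \<le> p" "p \<le> \<beta>"
    "\<And>u. \<alpha> < u \<Longrightarrow> u < p \<Longrightarrow> r u \<le> a" "\<And>u. p < u \<Longrightarrow> u < \<beta> \<Longrightarrow> a < r u"
proof -
  \<comment> \<open>\<open>\<alpha>\<close> is added so that the supremum exists when the function exceeds \<open>a\<close> throughout\<close>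
  define S where "S = insert \<alpha> {u \<in> {\<alpha><..<\<beta>}. r u \<le> a}"
  have S: "S \<noteq> {}" "bdd_above S"
    using assms by (auto simp: S_def intro!: bdd_aboveI[of _ \<beta>])
  show thesis
  proof
    show "\<alpha> \<le> Sup S" using S by (intro cSup_upper) (auto simp: S_def)
    show le: "Sup S \<le> \<beta>" using S assms by (intro cSup_least) (auto simp: S_def)
    show "r u \<le> a" if u: "\<alpha> < u" "u < Sup S" for u
    proof -
      obtain v where v: "v \<in> S" "u < v" using less_cSupD[OF S(1) u(2)] by auto
      then have "r v \<le> a" "v < \<beta>" "\<alpha> < v" using u by (auto simp: S_def)
      moreover have "r u \<le> r v"
        using assms v u \<open>v < \<beta>\<close> by (intro mono_onD[OF assms(1)]) auto
      ultimately show ?thesis by simp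
    qed
    show "a < r u" if u: "Sup S < u" "u < \<beta>" for u
    proof (rule ccontr)
      assume "\<not> a < r u"
      then have "u \<in> S" using u \<open>\<alpha> \<le> Sup S\<close> by (simp add: S_def)
      then show False using cSup_upper[OF _ S(2), of u] u by simp
    qed
  qed
qed

lemma Psi_eq_slice: "Psi a \<alpha> \<beta> q = slice \<alpha> \<beta> (\<lambda>u. stop_loss a (q u)) / (\<beta> - \<alpha>)"
  by (simp add: Psi_def slice_def rvar_weight_def)

lemma integrable_stop_loss:
  assumes "integrable unit_leb q"
  shows "integrable unit_leb (\<lambda>u. stop_loss a (q u))"
proof -
  have "integrable unit_leb (\<lambda>_. a)"
    by (rule integrable_bounded_unit_leb[where B = "\<bar>a\<bar>"]) auto
  then show ?thesis
    unfolding stop_loss_def using assms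
    by (intro Bochner_Integration.integrable_max Bochner_Integration.integrable_diff) auto
qed

text \<open>
  Beyond the crossing level the positive part is the identity, and before it the positive part vanishes.
\<close>

lemma slice_stop_loss_eq_upper_slice:
  assumes q: "q \<in> K_set" and "0 \<le> \<alpha>" "\<alpha> < \<beta>" "\<beta> \<le> 1"
  obtains p where "\<alpha> \<le> p" "p \<le> \<beta>"
    "slice \<alpha> \<beta> (\<lambda>u. stop_loss a (q u)) = slice p \<beta> q - a * (\<beta> - p)"
proof -
  have int: "integrable unit_leb q"
    using q by (auto simp: K_set_def integrable_if_L2_unit)
  obtain r where r: "mono_on {0<..<1} r" "AE u in unit_leb. q u = r u"
    using q by (auto simp: K_set_def)
  obtain p where p: "\<alpha> \<le> p" "p \<le> \<beta>"
    and below: "\<And>u. \<alpha> < u \<Longrightarrow> u < p \<Longrightarrow> r u \<le> a" and above: "\<And>u. p < u \<Longrightarrow> u < \<beta> \<Longrightarrow> a < r u"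
    using mono_on_threshold[OF r(1), of \<alpha> \<beta> a] assms by auto
  \<comment> \<open>the sign of \<open>r - a\<close> at \<open>p\<close> and at \<open>\<beta>\<close> is unknown, but single points are null sets\<close>
  have ne: "AE u in unit_leb. u \<noteq> c" for c :: real
  proof -
    have "AE u in lebesgue. u \<noteq> c"
      by (rule AE_completion[OF AE_lborel_singleton])
    then have "AE u in lebesgue. u \<in> {0<..<1} \<longrightarrow> u \<noteq> c"
      by eventually_elim simp
    then show ?thesis
      by (subst AE_restrict_space_iff) simp_all
  qed
  have "slice \<alpha> \<beta> (\<lambda>u. stop_loss a (q u)) = slice p \<beta> (\<lambda>u. q u - a)"
    unfolding slice_def
  proof (rule integral_cong_AE)
    show "AE u in unit_leb. indicator {\<alpha><..\<beta>} u * stop_loss a (q u)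
        = indicator {p<..\<beta>} u * (q u - a)"
      using r(2) ne[of p] ne[of \<beta>]
    proof eventually_elim
      case (elim u)
      then show ?case
        using below[of u] above[of u] p by (auto simp: indicator_def stop_loss_def)
    qed
  next
    show "(\<lambda>u. indicator {\<alpha><..\<beta>} u * stop_loss a (q u)) \<in> borel_measurable unit_leb"
      using integrable_stop_loss[OF int] by (intro borel_measurable_integrable integrable_slice)
    show "(\<lambda>u. indicator {p<..\<beta>} u * (q u - a)) \<in> borel_measurable unit_leb"
      using int by (intro borel_measurable_times borel_measurable_diff borel_measurable_unit_leb[of "indicator _"]) auto
  qed
  then show thesis
    using that[OF p] slice_diff_const[OF int, of p \<beta> a] p assms by simp
qed

text \<open>
  An upper bound for the integral of \<open>q - a\<close> over \<open>(p, \<beta>)\<close>; a two-level quantile that jumps at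
  \<open>p\<close> attains it.
\<close>

definition tail_gain :: "real \<Rightarrow> real \<Rightarrow> real \<Rightarrow> real \<Rightarrow> real \<Rightarrow> real" where
  "tail_gain \<mu> \<sigma> a \<beta> p = (\<beta> - p) * (Up \<mu> \<sigma> p - a)"

lemma Psi_nonneg: "\<alpha> < \<beta> \<Longrightarrow> 0 \<le> Psi a \<alpha> \<beta> q"
  unfolding Psi_def rvar_weight_def stop_loss_def
  by (intro integral_nonneg_AE AE_I2) (auto simp: indicator_def)

text \<open>
  The trivial case is a crossing at \<open>p = 1\<close>, where \<open>U\<^sub>p\<close> is undefined and the objective vanishes.
  The equation in the other case is kept, because uniqueness of maximizers needs to know when the
  inequality is tight.
\<close>

lemma Psi_le_tail_gain:
  assumes "0 < \<sigma>" "0 \<le> \<alpha>" "\<alpha> < \<beta>" "\<beta> \<le> 1" and q: "q \<in> K_set \<inter> M_set \<mu> \<sigma>"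
  obtains (trivial) "Psi a \<alpha> \<beta> q = 0"
    | (tail) p where "\<alpha> \<le> p" "p \<le> \<beta>" "p < 1"
      "(\<beta> - \<alpha>) * Psi a \<alpha> \<beta> q = slice p \<beta> q - a * (\<beta> - p)"
      "(\<beta> - \<alpha>) * Psi a \<alpha> \<beta> q \<le> tail_gain \<mu> \<sigma> a \<beta> p"
proof -
  obtain p where p: "\<alpha> \<le> p" "p \<le> \<beta>"
    and eq: "slice \<alpha> \<beta> (\<lambda>u. stop_loss a (q u)) = slice p \<beta> q - a * (\<beta> - p)"
    using slice_stop_loss_eq_upper_slice[of q \<alpha> \<beta> a] assms by auto
  have Psi: "(\<beta> - \<alpha>) * Psi a \<alpha> \<beta> q = slice p \<beta> q - a * (\<beta> - p)"
    using assms by (simp add: Psi_eq_slice eq)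
  show thesis
  proof (cases "p < 1")
    case True
    have "slice p \<beta> q \<le> (\<beta> - p) * Up \<mu> \<sigma> p"
      using slice_le_Up[OF assms(1) q] assms p True by simp
    then show thesis
      using tail[OF p True Psi] Psi by (simp add: tail_gain_def algebra_simps)
  next
    case False
    then have "p = \<beta>" using p assms by simp
    then have "(\<beta> - \<alpha>) * Psi a \<alpha> \<beta> q = 0" using Psi by (simp add: slice_def)
    then show thesis using trivial assms by simp
  qed
qed

lemma Psi_two_level:
  assumes "0 < \<nu>" "\<nu> < 1" "0 \<le> \<alpha>" "\<alpha> < \<beta>" "\<beta> \<le> 1" "\<alpha> \<le> \<nu>" "\<nu> \<le> \<beta>"
  shows "(\<beta> - \<alpha>) * Psi a \<alpha> \<beta> (two_level \<mu> \<sigma> \<nu>)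
    = (\<nu> - \<alpha>) * stop_loss a (Lo \<mu> \<sigma> \<nu>) + (\<beta> - \<nu>) * stop_loss a (Up \<mu> \<sigma> \<nu>)"
proof -
  have "integrable unit_leb (\<lambda>u. stop_loss a (two_level \<mu> \<sigma> \<nu> u))"
    by (rule integrable_two_level_comp) (simp add: stop_loss_def)
  from slice_two_step[OF this, of \<alpha> \<nu> \<beta> "stop_loss a (Lo \<mu> \<sigma> \<nu>)" "stop_loss a (Up \<mu> \<sigma> \<nu>)"]
  show ?thesis
    using assms by (simp add: Psi_eq_slice two_level_apply)
qed

text \<open>
  A strict peak of the tail gain settles the maximization: it bounds \<open>\<Psi>\<close>, the two-level quantile
  with its jump at the peak reaches the bound, and a quantile that reaches it must cross \<open>a\<close> at the peak
  and have an extremal upper tail there.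
\<close>

lemma two_level_unique_maximizer:
  assumes "0 < \<sigma>" "0 \<le> \<alpha>" "\<alpha> < \<beta>" "\<beta> \<le> 1"
    and \<nu>: "0 < \<nu>" "\<nu> < 1" "\<alpha> \<le> \<nu>" "\<nu> < \<beta>" "a < Up \<mu> \<sigma> \<nu>"
    and peak: "\<And>p. \<alpha> \<le> p \<Longrightarrow> p \<le> \<beta> \<Longrightarrow> p < 1 \<Longrightarrow> p \<noteq> \<nu> \<Longrightarrow> tail_gain \<mu> \<sigma> a \<beta> p < tail_gain \<mu> \<sigma> a \<beta> \<nu>"
  shows "Psi_max \<mu> \<sigma> a \<alpha> \<beta> = ereal (tail_gain \<mu> \<sigma> a \<beta> \<nu> / (\<beta> - \<alpha>))"
    and "is_unique_maximizer \<mu> \<sigma> a \<alpha> \<beta> (two_level \<mu> \<sigma> \<nu>)"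
proof -
  let ?g = "tail_gain \<mu> \<sigma> a \<beta>" and ?F = "K_set \<inter> M_set \<mu> \<sigma>" and ?h = "two_level \<mu> \<sigma> \<nu>"
  have pos: "0 < ?g \<nu>" using \<nu> by (simp add: tail_gain_def)
  have h: "?h \<in> ?F" using two_level_feasible assms by simp
  have le: "(\<beta> - \<alpha>) * Psi a \<alpha> \<beta> q \<le> ?g \<nu>" if "q \<in> ?F" for q
    using assms(1-4) that
  proof (cases rule: Psi_le_tail_gain[where a = a])
    case (tail p)
    then show ?thesis using peak[of p] by (cases "p = \<nu>") auto
  qed (use pos in simp)
  \<comment> \<open>dropping the lower level only loses value, so the upper bound forces equality\<close>
  have "0 \<le> (\<nu> - \<alpha>) * stop_loss a (Lo \<mu> \<sigma> \<nu>)"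
    using \<nu> by (simp add: stop_loss_def)
  then have "?g \<nu> \<le> (\<beta> - \<alpha>) * Psi a \<alpha> \<beta> ?h"
    using Psi_two_level[of \<nu> \<alpha> \<beta> a \<mu> \<sigma>] assms by (simp add: tail_gain_def stop_loss_def)
  with le[OF h] have Psi_h: "(\<beta> - \<alpha>) * Psi a \<alpha> \<beta> ?h = ?g \<nu>" by simp
  show max: "Psi_max \<mu> \<sigma> a \<alpha> \<beta> = ereal (?g \<nu> / (\<beta> - \<alpha>))"
    unfolding Psi_max_def
  proof (intro antisym SUP_least)
    show "ereal (Psi a \<alpha> \<beta> q) \<le> ereal (?g \<nu> / (\<beta> - \<alpha>))" if "q \<in> ?F" for q
      using le[OF that] assms by (simp add: field_simps)
    show "ereal (?g \<nu> / (\<beta> - \<alpha>)) \<le> (SUP q\<in>?F. ereal (Psi a \<alpha> \<beta> q))"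
      using Psi_h assms by (intro SUP_upper2[OF h]) (simp add: field_simps)
  qed
  have "AE u in unit_leb. q u = ?h u" if "is_maximizer \<mu> \<sigma> a \<alpha> \<beta> q" for q
  proof -
    have q: "q \<in> ?F" and "Psi a \<alpha> \<beta> q = ?g \<nu> / (\<beta> - \<alpha>)"
      using that by (auto simp: is_maximizer_def max)
    then have eq: "(\<beta> - \<alpha>) * Psi a \<alpha> \<beta> q = ?g \<nu>" using assms by simp
    from assms(1-4) q show ?thesis
    proof (cases rule: Psi_le_tail_gain[where a = a])
      case (tail p)
      then have "p = \<nu>" using peak[of p] eq by fastforce
      then have "slice \<nu> \<beta> q = (\<beta> - \<nu>) * Up \<mu> \<sigma> \<nu>"
        using tail eq by (simp add: tail_gain_def algebra_simps)
      then have "(\<beta> - \<nu>) * ((1 - \<nu>) * Up \<mu> \<sigma> \<nu>) \<le> (\<beta> - \<nu>) * slice \<nu> 1 q"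
        using slice_average_le_upper_tail[of q \<nu> \<beta>] q assms by (simp add: mult.left_commute)
      then have "(1 - \<nu>) * Up \<mu> \<sigma> \<nu> \<le> slice \<nu> 1 q"
        using \<nu> by simp
      then show ?thesis
        using upper_tail_le[of \<sigma> \<nu> q \<mu>] assms q
        by (intro upper_tail_eq_imp_two_level) auto
    qed (use eq pos in simp)
  qed
  then show "is_unique_maximizer \<mu> \<sigma> a \<alpha> \<beta> ?h"
    using h Psi_h assms by (auto simp: is_unique_maximizer_def is_maximizer_def max field_simps)
qed

text \<open>
  Here \<open>U\<^sub>p \<le> a\<close> for every crossing level, so the objective vanishes on the whole feasible set.
\<close>

lemma Psi_max_above_Up:
  assumes "0 < \<sigma>" "0 \<le> \<alpha>" "\<alpha> < \<beta>" "\<beta> < 1" "Up \<mu> \<sigma> \<beta> \<le> a"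
  shows "Psi_max \<mu> \<sigma> a \<alpha> \<beta> = 0" "is_maximizer \<mu> \<sigma> a \<alpha> \<beta> (two_level \<mu> \<sigma> \<beta>)"
proof -
  let ?F = "K_set \<inter> M_set \<mu> \<sigma>"
  have h: "two_level \<mu> \<sigma> \<beta> \<in> ?F" using two_level_feasible assms by simp
  have zero: "Psi a \<alpha> \<beta> q = 0" if "q \<in> ?F" for q
  proof -
    have "\<beta> \<le> 1" using assms by simp
    from assms(1-3) this that show ?thesis
    proof (cases rule: Psi_le_tail_gain[where a = a])
      case (tail p)
      have "Up \<mu> \<sigma> p \<le> a"
        using Up_less[of \<sigma> p \<beta> \<mu>] assms tail by (cases "p = \<beta>") auto
      then have "tail_gain \<mu> \<sigma> a \<beta> p \<le> 0"
        using tail by (simp add: tail_gain_def mult_le_0_iff)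
      then have "(\<beta> - \<alpha>) * Psi a \<alpha> \<beta> q \<le> 0" using tail by simp
      then show ?thesis
        using Psi_nonneg[OF assms(3), of a q] assms by (simp add: mult_le_0_iff)
    qed
  qed
  have "(SUP q\<in>?F. ereal (Psi a \<alpha> \<beta> q)) = (SUP q\<in>?F. 0)"
    using zero by (intro SUP_cong) auto
  also have "\<dots> = 0"
    using h by (intro SUP_const) auto
  finally show max: "Psi_max \<mu> \<sigma> a \<alpha> \<beta> = 0"
    by (simp add: Psi_max_def)
  show "is_maximizer \<mu> \<sigma> a \<alpha> \<beta> (two_level \<mu> \<sigma> \<beta>)"
    unfolding is_maximizer_def max using h zero by simp
qed

section \<open>The minimum\<close>

text \<open>
  Jensen's inequality for the positive part: both \<open>x - a\<close> and \<open>0\<close> lie below it.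
\<close>

lemma Psi_ge_Lo:
  assumes "0 < \<sigma>" "0 \<le> \<alpha>" "\<alpha> < \<beta>" "\<beta> \<le> 1" and q: "q \<in> K_set \<inter> M_set \<mu> \<sigma>"
  shows "max (Lo \<mu> \<sigma> \<beta> - a) 0 \<le> Psi a \<alpha> \<beta> q"
proof -
  have int: "integrable unit_leb q" using q M_setD by auto
  have c: "integrable unit_leb (\<lambda>_. a)"
    by (rule integrable_bounded_unit_leb[where B = "\<bar>a\<bar>"]) auto
  have "(\<beta> - \<alpha>) * Lo \<mu> \<sigma> \<beta> - a * (\<beta> - \<alpha>) \<le> slice \<alpha> \<beta> q - a * (\<beta> - \<alpha>)"
    using slice_ge_Lo[OF assms(1) q assms(2-4)] by simp
  also have "\<dots> = slice \<alpha> \<beta> (\<lambda>u. q u - a)"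
    using slice_diff_const[OF int, of \<alpha> \<beta> a] assms by simp
  also have "\<dots> \<le> slice \<alpha> \<beta> (\<lambda>u. stop_loss a (q u))"
    by (intro slice_mono integrable_stop_loss Bochner_Integration.integrable_diff int c AE_I2)
      (simp add: stop_loss_def)
  finally have "Lo \<mu> \<sigma> \<beta> - a \<le> Psi a \<alpha> \<beta> q"
    using assms by (simp add: Psi_eq_slice field_simps)
  then show ?thesis using Psi_nonneg[OF assms(3)] by simp
qed

lemma Psi_min_attained:
  assumes "0 < \<sigma>" "0 \<le> \<alpha>" "\<alpha> < \<beta>" "\<beta> < 1"
  shows "Psi_min \<mu> \<sigma> a \<alpha> \<beta> = ereal (max (Lo \<mu> \<sigma> \<beta> - a) 0)"
    and "is_minimizer \<mu> \<sigma> a \<alpha> \<beta> (two_level \<mu> \<sigma> \<beta>)"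
proof -
  have h: "two_level \<mu> \<sigma> \<beta> \<in> K_set \<inter> M_set \<mu> \<sigma>" using two_level_feasible assms by simp
  have Psi_h: "Psi a \<alpha> \<beta> (two_level \<mu> \<sigma> \<beta>) = max (Lo \<mu> \<sigma> \<beta> - a) 0"
    using Psi_two_level[of \<beta> \<alpha> \<beta> a \<mu> \<sigma>] assms by (simp add: stop_loss_def)
  show min: "Psi_min \<mu> \<sigma> a \<alpha> \<beta> = ereal (max (Lo \<mu> \<sigma> \<beta> - a) 0)"
    unfolding Psi_min_def
  proof (intro antisym INF_greatest)
    show "(INF q\<in>K_set \<inter> M_set \<mu> \<sigma>. ereal (Psi a \<alpha> \<beta> q)) \<le> ereal (max (Lo \<mu> \<sigma> \<beta> - a) 0)"
      by (rule INF_lower2[OF h]) (simp add: Psi_h)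
    show "ereal (max (Lo \<mu> \<sigma> \<beta> - a) 0) \<le> ereal (Psi a \<alpha> \<beta> q)"
      if "q \<in> K_set \<inter> M_set \<mu> \<sigma>" for q
      using Psi_ge_Lo[OF assms(1-3) _ that] assms by simp
  qed
  show "is_minimizer \<mu> \<sigma> a \<alpha> \<beta> (two_level \<mu> \<sigma> \<beta>)"
    unfolding is_minimizer_def min Psi_h using h by simp
qed

text \<open>
  For \<open>\<beta> = 1\<close> the bound is approached by two-level quantiles whose jump \<open>\<nu>\<close> tends to \<open>1\<close>: the
  lower level tends to \<open>\<mu>\<close>, and the upper level grows only like \<open>1 / sqrt (1 - \<nu>)\<close>, so
  that its contribution to the objective vanishes.
\<close>

lemma Psi_min_upper_level_one:
  assumes "0 < \<sigma>" "0 \<le> \<alpha>" "\<alpha> < 1"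
  shows "Psi_min \<mu> \<sigma> a \<alpha> 1 = ereal (max (Lo \<mu> \<sigma> 1 - a) 0)"
proof (rule antisym)
  show "ereal (max (Lo \<mu> \<sigma> 1 - a) 0) \<le> Psi_min \<mu> \<sigma> a \<alpha> 1"
    unfolding Psi_min_def using Psi_ge_Lo[OF assms order_refl, of _ \<mu> a]
    by (intro INF_greatest) (simp only: ereal_less_eq)
  let ?f = "\<lambda>\<nu>. ((\<nu> - \<alpha>) * max (Lo \<mu> \<sigma> \<nu> - a) 0
    + max ((1 - \<nu>) * (Up \<mu> \<sigma> \<nu> - a)) 0) / (1 - \<alpha>)"
  have "(Lo \<mu> \<sigma> \<longlongrightarrow> \<mu>) (at_left 1)"
    unfolding Lo_def by real_asymp
  moreover have "((\<lambda>\<nu>. (1 - \<nu>) * (Up \<mu> \<sigma> \<nu> - a)) \<longlongrightarrow> 0) (at_left 1)"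
    unfolding Up_def by real_asymp
  ultimately have "(?f \<longlongrightarrow> ((1 - \<alpha>) * max (\<mu> - a) 0 + max 0 0) / (1 - \<alpha>)) (at_left 1)"
    using assms by (intro tendsto_intros) auto
  then have "(?f \<longlongrightarrow> max (Lo \<mu> \<sigma> 1 - a) 0) (at_left 1)"
    using assms by (simp add: Lo_def[of \<mu> \<sigma> 1])
  then have lim: "((\<lambda>\<nu>. ereal (?f \<nu>)) \<longlongrightarrow> ereal (max (Lo \<mu> \<sigma> 1 - a) 0)) (at_left 1)"
    by (rule tendsto_ereal)
  have ev: "\<forall>\<^sub>F \<nu> in at_left 1. \<nu> \<in> {\<alpha><..<1}"
    using assms eventually_at_left by (intro eventually_at_leftI[of \<alpha>]) auto
  have "\<forall>\<^sub>F \<nu> in at_left 1. Psi_min \<mu> \<sigma> a \<alpha> 1 \<le> ereal (?f \<nu>)"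
    using ev
  proof eventually_elim
    case (elim \<nu>)
    then have \<nu>: "0 < \<nu>" "\<nu> < 1" "\<alpha> < \<nu>" using assms by auto
    have "(1 - \<nu>) * max (Up \<mu> \<sigma> \<nu> - a) 0 = max ((1 - \<nu>) * (Up \<mu> \<sigma> \<nu> - a)) 0"
      using \<nu> by (auto simp: max_def mult_le_0_iff)
    then have "Psi a \<alpha> 1 (two_level \<mu> \<sigma> \<nu>) = ?f \<nu>"
      using Psi_two_level[of \<nu> \<alpha> 1 a \<mu> \<sigma>] assms \<nu> by (simp add: stop_loss_def field_simps)
    then show ?case
      unfolding Psi_min_def
      by (intro INF_lower2[OF two_level_feasible[OF assms(1) \<nu>(1,2)]]) simp
  qed
  then show "Psi_min \<mu> \<sigma> a \<alpha> 1 \<le> ereal (max (Lo \<mu> \<sigma> 1 - a) 0)"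
    by (intro tendsto_lowerbound[OF lim]) auto
qed

section \<open>The quartic and the shape of the tail gain\<close>

text \<open>
  Dividing the quartic by \<open>t\<close> leaves an increasing function of \<open>t > 0\<close>. The proof compares the
  quotients at \<open>s\<close> and \<open>t\<close> after clearing denominators: the linear terms cancel, and \<open>t - s\<close>
  splits off with a positive cofactor.
\<close>

lemma quartic_sign:
  assumes "0 < \<beta>" "\<beta> \<le> 1" "0 < s" "quartic \<mu> \<sigma> a \<beta> s = 0" "0 < t"
  shows "t < s \<Longrightarrow> quartic \<mu> \<sigma> a \<beta> t < 0" and "s < t \<Longrightarrow> 0 < quartic \<mu> \<sigma> a \<beta> t"
proof -
  let ?B = "(1 - \<beta>) * (s * t * (t\<^sup>2 + t * s + s\<^sup>2)) + (3 - 2 * \<beta>) * (s * t) + \<beta>"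
  have "s * quartic \<mu> \<sigma> a \<beta> t - t * quartic \<mu> \<sigma> a \<beta> s = (t - s) * ?B"
    unfolding quartic_def by algebra
  then have eq: "s * quartic \<mu> \<sigma> a \<beta> t = (t - s) * ?B"
    using assms(4) by simp
  have B: "0 < ?B"
    using assms by (intro add_nonneg_pos add_nonneg_nonneg mult_nonneg_nonneg) auto
  show "quartic \<mu> \<sigma> a \<beta> t < 0" if "t < s"
  proof -
    have "s * quartic \<mu> \<sigma> a \<beta> t < 0"
      unfolding eq using that B by (intro mult_neg_pos) auto
    then show ?thesis using assms(3) by (simp add: mult_less_0_iff)
  qed
  show "0 < quartic \<mu> \<sigma> a \<beta> t" if "s < t"
  proof -
    have "0 < s * quartic \<mu> \<sigma> a \<beta> t"
      unfolding eq using that B by (intro mult_pos_pos) auto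
    then show ?thesis using assms(3) by (simp add: zero_less_mult_iff)
  qed
qed

lemma quartic_unique_root:
  assumes "0 < \<beta>" "\<beta> \<le> 1"
  shows "\<exists>!t. 0 < t \<and> quartic \<mu> \<sigma> a \<beta> t = 0"
proof -
  define c where "c = 2 * (\<mu> - a) / \<sigma>"
  have quartic: "quartic \<mu> \<sigma> a \<beta> t = (1 - \<beta>) * t ^ 4 + (3 - 2 * \<beta>) * t\<^sup>2 + c * t - \<beta>" for t
    by (simp add: quartic_def c_def)
  \<comment> \<open>this \<open>M\<close> makes both \<open>M\<close> and \<open>M + c\<close> at least \<open>1 \<ge> \<beta>\<close>\<close>
  define M where "M = 1 + \<bar>c\<bar>"
  have M: "1 \<le> M" by (simp add: M_def)
  have "0 \<le> M * (M + c) - \<beta>"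
  proof -
    have "1 * 1 \<le> M * (M + c)"
      using M by (intro mult_mono) (auto simp: M_def)
    then show ?thesis using assms by simp
  qed
  also have "M * (M + c) - \<beta> \<le> quartic \<mu> \<sigma> a \<beta> M"
  proof -
    have "0 \<le> (1 - \<beta>) * M ^ 4" "0 \<le> (2 - 2 * \<beta>) * M\<^sup>2"
      using assms M by (intro mult_nonneg_nonneg; simp)+
    then show ?thesis
      by (simp add: quartic algebra_simps power2_eq_square)
  qed
  finally have "0 \<le> quartic \<mu> \<sigma> a \<beta> M" .
  moreover have "quartic \<mu> \<sigma> a \<beta> 0 \<le> 0" using assms by (simp add: quartic_def)
  moreover have "continuous_on {0..M} (quartic \<mu> \<sigma> a \<beta>)"
    unfolding quartic_def by (intro continuous_intros)
  ultimately obtain s where s: "0 \<le> s" "quartic \<mu> \<sigma> a \<beta> s = 0"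
    using IVT'[of "quartic \<mu> \<sigma> a \<beta>" 0 0 M] M by auto
  then have "0 < s" using assms by (cases "s = 0") (auto simp: quartic_def)
  show ?thesis
  proof (rule ex1I[of _ s])
    fix t assume "0 < t \<and> quartic \<mu> \<sigma> a \<beta> t = 0"
    then show "t = s"
      using quartic_sign[OF assms \<open>0 < s\<close> s(2), of t] by (cases t s rule: linorder_cases) auto
  qed (use s \<open>0 < s\<close> in auto)
qed

lemma t_star_root:
  assumes "0 < \<beta>" "\<beta> \<le> 1"
  shows "0 < t_star \<mu> \<sigma> a \<beta>" "quartic \<mu> \<sigma> a \<beta> (t_star \<mu> \<sigma> a \<beta>) = 0"
  using theI'[OF quartic_unique_root[OF assms, of \<mu> \<sigma> a]] unfolding t_star_def by simp_all

lemma t_star_eqI: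
  assumes "0 < \<beta>" "\<beta> \<le> 1" "0 < t" "quartic \<mu> \<sigma> a \<beta> t = 0"
  shows "t_star \<mu> \<sigma> a \<beta> = t"
  unfolding t_star_def
  by (rule the1_equality[OF quartic_unique_root[OF assms(1,2)]]) (use assms(3,4) in simp)

lemma odds_root_p_star:
  assumes "0 < \<beta>" "\<beta> \<le> 1"
  shows "0 < p_star \<mu> \<sigma> a \<beta>" "p_star \<mu> \<sigma> a \<beta> < 1"
    "odds_root (p_star \<mu> \<sigma> a \<beta>) = t_star \<mu> \<sigma> a \<beta>"
proof -
  have "0 < t_star \<mu> \<sigma> a \<beta>" using t_star_root assms by simp
  then show "p_star \<mu> \<sigma> a \<beta> < 1"
    "odds_root (p_star \<mu> \<sigma> a \<beta>) = t_star \<mu> \<sigma> a \<beta>"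
    unfolding p_star_def using odds_root_inverse[of "t_star \<mu> \<sigma> a \<beta>"] by auto
  show "0 < p_star \<mu> \<sigma> a \<beta>"
    unfolding p_star_def using \<open>0 < t_star \<mu> \<sigma> a \<beta>\<close>
    by (intro divide_pos_pos add_pos_nonneg) auto
qed

text \<open>
  The tail gain at the jump level \<open>t\<^sup>2 / (1 + t\<^sup>2)\<close>, where it can be differentiated without square roots.
\<close>

definition gain_in_odds :: "real \<Rightarrow> real \<Rightarrow> real \<Rightarrow> real \<Rightarrow> real \<Rightarrow> real" where
  "gain_in_odds \<mu> \<sigma> a \<beta> t = (\<beta> - t\<^sup>2 / (1 + t\<^sup>2)) * (\<mu> - a + \<sigma> * t)"

lemma tail_gain_eq_gain_in_odds:
  assumes "0 \<le> p" "p < 1"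
  shows "tail_gain \<mu> \<sigma> a \<beta> p = gain_in_odds \<mu> \<sigma> a \<beta> (odds_root p)"
  unfolding gain_in_odds_def odds_root_square(1)[OF assms, symmetric]
  by (simp add: tail_gain_def Up_odds_root)

text \<open>
  This is where the quartic comes from: it is the first-order condition for the jump level.
\<close>

lemma DERIV_gain_in_odds:
  assumes "0 < \<sigma>"
  shows "(gain_in_odds \<mu> \<sigma> a \<beta> has_real_derivative
    - \<sigma> * quartic \<mu> \<sigma> a \<beta> t / (1 + t\<^sup>2)\<^sup>2) (at t)"
proof -
  have nz: "1 + t\<^sup>2 \<noteq> 0" by (smt (verit) zero_le_power2)
  have "(gain_in_odds \<mu> \<sigma> a \<beta> has_real_derivative
      (\<beta> - t\<^sup>2 / (1 + t\<^sup>2)) * \<sigma>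
      - (2 * t * (1 + t\<^sup>2) - t\<^sup>2 * (2 * t)) / (1 + t\<^sup>2)\<^sup>2 * (\<mu> - a + \<sigma> * t)) (at t)"
    unfolding gain_in_odds_def
    using nz by (auto intro!: derivative_eq_intros simp: power2_eq_square)
  moreover have "(\<beta> - t\<^sup>2 / (1 + t\<^sup>2)) * \<sigma>
      - (2 * t * (1 + t\<^sup>2) - t\<^sup>2 * (2 * t)) / (1 + t\<^sup>2)\<^sup>2 * (\<mu> - a + \<sigma> * t)
    = - \<sigma> * quartic \<mu> \<sigma> a \<beta> t / (1 + t\<^sup>2)\<^sup>2"
  proof -
    have "\<sigma> * quartic \<mu> \<sigma> a \<beta> t
      = \<sigma> * ((1 - \<beta>) * t ^ 4 + (3 - 2 * \<beta>) * t\<^sup>2 - \<beta>) + 2 * (\<mu> - a) * t"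
    proof -
      have "\<sigma> * (2 * (\<mu> - a) / \<sigma>) = 2 * (\<mu> - a)"
        using assms by simp
      then show ?thesis unfolding quartic_def by algebra
    qed
    moreover have "(\<beta> - t\<^sup>2 / (1 + t\<^sup>2)) * \<sigma> = \<sigma> * (\<beta> * (1 + t\<^sup>2) - t\<^sup>2) * (1 + t\<^sup>2) / (1 + t\<^sup>2)\<^sup>2"
    proof -
      have "(\<beta> - x / d) * \<sigma> = \<sigma> * (\<beta> * d - x) * d / d\<^sup>2" if "d \<noteq> 0" for x d :: real
        using that by (simp add: field_simps power2_eq_square)
      then show ?thesis using nz by blast
    qed
    moreover have "\<sigma> * (\<beta> * (1 + t\<^sup>2) - t\<^sup>2) * (1 + t\<^sup>2)
        - (2 * t * (1 + t\<^sup>2) - t\<^sup>2 * (2 * t)) * (\<mu> - a + \<sigma> * t)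
      = - (\<sigma> * ((1 - \<beta>) * t ^ 4 + (3 - 2 * \<beta>) * t\<^sup>2 - \<beta>) + 2 * (\<mu> - a) * t)"
      by algebra
    ultimately show ?thesis
      by (simp add: diff_divide_distrib[symmetric])
  qed
  ultimately show ?thesis by simp
qed

lemma tail_gain_strict_mono:
  assumes "0 < \<sigma>" "0 < \<beta>" "\<beta> \<le> 1" "0 \<le> p" "p < r" "r < 1"
  shows "odds_root r \<le> t_star \<mu> \<sigma> a \<beta> \<Longrightarrow> tail_gain \<mu> \<sigma> a \<beta> p < tail_gain \<mu> \<sigma> a \<beta> r"
    and "t_star \<mu> \<sigma> a \<beta> \<le> odds_root p \<Longrightarrow> tail_gain \<mu> \<sigma> a \<beta> r < tail_gain \<mu> \<sigma> a \<beta> p"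
proof -
  let ?s = "t_star \<mu> \<sigma> a \<beta>" and ?f = "gain_in_odds \<mu> \<sigma> a \<beta>"
  note sign = quartic_sign[OF assms(2,3) t_star_root[OF assms(2,3)], of _ \<mu> \<sigma> a]
  have odds: "0 \<le> odds_root p" "odds_root p < odds_root r"
    using odds_root_less odds_root_square assms by auto
  have denom: "0 < (1 + t\<^sup>2)\<^sup>2" for t :: real
    by (smt (verit) zero_le_power2 zero_less_power2)
  have cont: "continuous_on {odds_root p..odds_root r} ?f"
    by (rule DERIV_continuous_on[OF has_field_derivative_at_within[OF DERIV_gain_in_odds[OF assms(1)]]])
  have gain: "tail_gain \<mu> \<sigma> a \<beta> p = ?f (odds_root p)" "tail_gain \<mu> \<sigma> a \<beta> r = ?f (odds_root r)"
    using tail_gain_eq_gain_in_odds assms by auto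
  show "tail_gain \<mu> \<sigma> a \<beta> p < tail_gain \<mu> \<sigma> a \<beta> r" if "odds_root r \<le> ?s"
    unfolding gain
  proof (rule DERIV_pos_imp_increasing_open[OF odds(2) _ cont])
    fix t assume t: "odds_root p < t" "t < odds_root r"
    have "0 < - \<sigma> * quartic \<mu> \<sigma> a \<beta> t / (1 + t\<^sup>2)\<^sup>2"
      using sign(1)[of t] t that odds denom assms
      by (intro divide_pos_pos mult_neg_neg) auto
    then show "\<exists>y. (?f has_real_derivative y) (at t) \<and> 0 < y"
      using DERIV_gain_in_odds[OF assms(1)] by blast
  qed
  show "tail_gain \<mu> \<sigma> a \<beta> r < tail_gain \<mu> \<sigma> a \<beta> p" if "?s \<le> odds_root p"
    unfolding gain
  proof (rule DERIV_neg_imp_decreasing_open[OF odds(2) _ cont])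
    fix t assume t: "odds_root p < t" "t < odds_root r"
    have "- \<sigma> * quartic \<mu> \<sigma> a \<beta> t / (1 + t\<^sup>2)\<^sup>2 < 0"
      using sign(2)[of t] t that odds denom assms
      by (intro divide_neg_pos mult_neg_pos) auto
    then show "\<exists>y. (?f has_real_derivative y) (at t) \<and> y < 0"
      using DERIV_gain_in_odds[OF assms(1)] by blast
  qed
qed

text \<open>
  The regime boundary \<open>T\<close> as a function of its two levels. Evaluated at two equal
  levels it becomes \<open>U\<close>, so that this single function describes both regime boundaries.
\<close>

definition lower_threshold :: "real \<Rightarrow> real \<Rightarrow> real \<Rightarrow> real \<Rightarrow> real" where
  "lower_threshold \<mu> \<sigma> \<nu> \<beta> =
     \<mu> + \<sigma> * ((- 2 * \<nu>\<^sup>2 + 3 * \<nu> - \<beta>) / (2 * (1 - \<nu>) * sqrt (\<nu> * (1 - \<nu>))))"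

lemma sqrt_odds_denominator:
  assumes "0 < \<nu>" "\<nu> < 1"
  shows "sqrt (\<nu> * (1 - \<nu>)) = (1 - \<nu>) * odds_root \<nu>"
proof -
  have "((1 - \<nu>) * odds_root \<nu>)\<^sup>2 = \<nu> * (1 - \<nu>)"
  proof -
    have "(odds_root \<nu>)\<^sup>2 = \<nu> / (1 - \<nu>)"
      using assms by (simp add: odds_root_def)
    then show ?thesis
      using assms by (simp add: power_mult_distrib) (simp add: power2_eq_square)
  qed
  then show ?thesis
    using assms odds_root_square(2)[of \<nu>] by (intro real_sqrt_unique) auto
qed

lemma lower_threshold_diagonal:
  assumes "0 < \<nu>" "\<nu> < 1"
  shows "lower_threshold \<mu> \<sigma> \<nu> \<nu> = Up \<mu> \<sigma> \<nu>"
proof -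
  have sq: "(odds_root \<nu>)\<^sup>2 = \<nu> / (1 - \<nu>)" and nz: "odds_root \<nu> \<noteq> 0"
    using assms by (auto simp: odds_root_def)
  have "- 2 * \<nu>\<^sup>2 + 3 * \<nu> - \<nu> = 2 * (1 - \<nu>) * ((1 - \<nu>) * (odds_root \<nu>)\<^sup>2)"
    unfolding sq using assms by (simp add: field_simps power2_eq_square)
  \<comment> \<open>the denominator is written in the form that \<open>sqrt_odds_denominator\<close> produces\<close>
  then have "(- 2 * \<nu>\<^sup>2 + 3 * \<nu> - \<nu>) / (2 * (1 - \<nu>) * ((1 - \<nu>) * odds_root \<nu>)) = odds_root \<nu>"
    using assms nz by (simp add: power2_eq_square)
  then show ?thesis
    unfolding lower_threshold_def sqrt_odds_denominator[OF assms] Up_odds_root by simp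
qed

lemma lower_threshold_strict_antimono:
  assumes "0 < \<sigma>" "0 < \<nu>" "\<nu> < 1" "\<beta> < \<beta>'"
  shows "lower_threshold \<mu> \<sigma> \<nu> \<beta>' < lower_threshold \<mu> \<sigma> \<nu> \<beta>"
proof -
  have "0 < 2 * (1 - \<nu>) * sqrt (\<nu> * (1 - \<nu>))"
    using assms by simp
  then have "(- 2 * \<nu>\<^sup>2 + 3 * \<nu> - \<beta>') / (2 * (1 - \<nu>) * sqrt (\<nu> * (1 - \<nu>)))
    < (- 2 * \<nu>\<^sup>2 + 3 * \<nu> - \<beta>) / (2 * (1 - \<nu>) * sqrt (\<nu> * (1 - \<nu>)))"
    using assms(4) by (intro divide_strict_right_mono) auto
  then show ?thesis
    unfolding lower_threshold_def using assms(1) by (simp only: add_less_cancel_left mult_less_cancel_left_pos)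
qed

text \<open>
  For fixed \<open>t\<close> the quartic is affine in \<open>a\<close>. Its zero in \<open>a\<close>, at \<open>t = odds_root \<nu>\<close>, is the
  threshold.
\<close>

lemma quartic_at_odds_root:
  assumes "0 < \<sigma>" "0 < \<nu>" "\<nu> < 1"
  shows "quartic \<mu> \<sigma> a \<beta> (odds_root \<nu>)
    = 2 * odds_root \<nu> / \<sigma> * (lower_threshold \<mu> \<sigma> \<nu> \<beta> - a)"
proof -
  define t where "t = odds_root \<nu>"
  have sq: "t\<^sup>2 = \<nu> / (1 - \<nu>)" and nz: "t \<noteq> 0"
    using assms by (auto simp: t_def odds_root_def)
  have t4: "t ^ 4 = \<nu>\<^sup>2 / (1 - \<nu>)\<^sup>2"
    using arg_cong[OF sq, of "\<lambda>x. x\<^sup>2"] by (simp add: power_divide)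
  have "(1 - \<beta>) * t ^ 4 + (3 - 2 * \<beta>) * t\<^sup>2 - \<beta> = (- 2 * \<nu>\<^sup>2 + 3 * \<nu> - \<beta>) / (1 - \<nu>)\<^sup>2"
  proof -
    have "(1 - \<nu>)\<^sup>2 * ((1 - \<beta>) * t ^ 4 + (3 - 2 * \<beta>) * t\<^sup>2 - \<beta>)
      = (1 - \<beta>) * ((1 - \<nu>)\<^sup>2 * t ^ 4) + (3 - 2 * \<beta>) * ((1 - \<nu>) * ((1 - \<nu>) * t\<^sup>2)) - \<beta> * (1 - \<nu>)\<^sup>2"
      by (simp add: algebra_simps power2_eq_square)
    also have "\<dots> = (1 - \<beta>) * \<nu>\<^sup>2 + (3 - 2 * \<beta>) * ((1 - \<nu>) * \<nu>) - \<beta> * (1 - \<nu>)\<^sup>2"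
      unfolding t4 sq using assms by simp
    also have "\<dots> = - 2 * \<nu>\<^sup>2 + 3 * \<nu> - \<beta>"
      by algebra
    finally show ?thesis using assms by (simp add: field_simps)
  qed
  then have "quartic \<mu> \<sigma> a \<beta> t = (- 2 * \<nu>\<^sup>2 + 3 * \<nu> - \<beta>) / (1 - \<nu>)\<^sup>2 + 2 * (\<mu> - a) / \<sigma> * t"
    by (simp add: quartic_def)
  also have "\<dots> = 2 * t / \<sigma> * (\<mu> + \<sigma> * ((- 2 * \<nu>\<^sup>2 + 3 * \<nu> - \<beta>) / (2 * (1 - \<nu>) * ((1 - \<nu>) * t))) - a)"
  proof -
    have expand: "2 * t / \<sigma> * (\<mu> + x - a) = 2 * t / \<sigma> * x + 2 * (\<mu> - a) / \<sigma> * t" for x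
      using assms by (simp add: field_simps)
    have cancel': "2 * t / \<sigma> * (\<sigma> * (N / (2 * w * (w * t)))) = N / w\<^sup>2" if "w \<noteq> 0" for N w
      using assms nz that by (simp add: power2_eq_square)
    have cancel: "2 * t / \<sigma> * (\<sigma> * (N / (2 * (1 - \<nu>) * ((1 - \<nu>) * t)))) = N / (1 - \<nu>)\<^sup>2" for N
      by (rule cancel') (use assms in simp)
    show ?thesis
      unfolding expand cancel by simp
  qed
  finally show ?thesis
    unfolding lower_threshold_def sqrt_odds_denominator[OF assms(2,3)] t_def .
qed

lemma t_star_le_odds_root_iff:
  assumes "0 < \<sigma>" "0 < \<beta>" "\<beta> \<le> 1" "0 < \<nu>" "\<nu> < 1"
  shows "t_star \<mu> \<sigma> a \<beta> \<le> odds_root \<nu> \<longleftrightarrow> a \<le> lower_threshold \<mu> \<sigma> \<nu> \<beta>"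
    and "t_star \<mu> \<sigma> a \<beta> < odds_root \<nu> \<longleftrightarrow> a < lower_threshold \<mu> \<sigma> \<nu> \<beta>"
proof -
  let ?s = "t_star \<mu> \<sigma> a \<beta>" and ?t = "odds_root \<nu>" and ?Q = "quartic \<mu> \<sigma> a \<beta>"
  have t: "0 < ?t" using assms by (simp add: odds_root_def)
  then have Q: "0 \<le> ?Q ?t \<longleftrightarrow> a \<le> lower_threshold \<mu> \<sigma> \<nu> \<beta>"
    "0 < ?Q ?t \<longleftrightarrow> a < lower_threshold \<mu> \<sigma> \<nu> \<beta>"
    unfolding quartic_at_odds_root[OF assms(1,4,5)] using assms(1)
    by (auto simp: zero_le_mult_iff zero_less_mult_iff zero_le_divide_iff zero_less_divide_iff)
  note sign = quartic_sign[OF assms(2,3) t_star_root[OF assms(2,3)] t, of \<mu> \<sigma> a]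
  have root: "?Q ?s = 0" using t_star_root assms by simp
  consider "?t < ?s" | "?t = ?s" | "?s < ?t" by linarith
  then have "(?s \<le> ?t \<longleftrightarrow> 0 \<le> ?Q ?t) \<and> (?s < ?t \<longleftrightarrow> 0 < ?Q ?t)"
  proof cases
    case 1
    then show ?thesis using sign(1) by simp
  next
    case 2
    then show ?thesis using root by simp
  next
    case 3
    then show ?thesis using sign(2) by simp
  qed
  then show "?s \<le> ?t \<longleftrightarrow> a \<le> lower_threshold \<mu> \<sigma> \<nu> \<beta>" "?s < ?t \<longleftrightarrow> a < lower_threshold \<mu> \<sigma> \<nu> \<beta>"
    unfolding Q by simp_all
qed

section \<open>The maximum in the three regimes\<close>

lemma T_ext_eq_lower_threshold:
  "T_ext \<mu> \<sigma> \<alpha> \<beta> = (if \<alpha> = 0 then - \<infinity> else ereal (lower_threshold \<mu> \<sigma> \<alpha> \<beta>))"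
  by (simp add: T_ext_def lower_threshold_def)

lemma regime_boundaries_ordered:
  assumes "0 < \<sigma>" "0 \<le> \<alpha>" "\<alpha> < \<beta>" "\<beta> \<le> 1"
  shows "T_ext \<mu> \<sigma> \<alpha> \<beta> \<le> Up_ext \<mu> \<sigma> \<alpha>" "Up_ext \<mu> \<sigma> \<alpha> < Up_ext \<mu> \<sigma> \<beta>"
proof -
  show "T_ext \<mu> \<sigma> \<alpha> \<beta> \<le> Up_ext \<mu> \<sigma> \<alpha>"
  proof (cases "\<alpha> = 0")
    case False
    then show ?thesis
      using lower_threshold_strict_antimono[of \<sigma> \<alpha> \<alpha> \<beta> \<mu>] lower_threshold_diagonal[of \<alpha> \<mu> \<sigma>] assms
      by (simp add: T_ext_eq_lower_threshold Up_ext_def)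
  qed (simp add: T_ext_def)
  show "Up_ext \<mu> \<sigma> \<alpha> < Up_ext \<mu> \<sigma> \<beta>"
    using Up_less[of \<sigma> \<alpha> \<beta> \<mu>] assms by (simp add: Up_ext_def)
qed

lemma Psi_max_below_lower_threshold:
  assumes "0 < \<sigma>" "0 < \<alpha>" "\<alpha> < \<beta>" "\<beta> \<le> 1" "a \<le> lower_threshold \<mu> \<sigma> \<alpha> \<beta>"
  shows "Psi_max \<mu> \<sigma> a \<alpha> \<beta> = ereal (Up \<mu> \<sigma> \<alpha> - a)"
    and "is_unique_maximizer \<mu> \<sigma> a \<alpha> \<beta> (two_level \<mu> \<sigma> \<alpha>)"
proof -
  have above: "a < Up \<mu> \<sigma> \<alpha>"
    using lower_threshold_strict_antimono[of \<sigma> \<alpha> \<alpha> \<beta> \<mu>] lower_threshold_diagonal[of \<alpha> \<mu> \<sigma>] assms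
    by simp
  have "t_star \<mu> \<sigma> a \<beta> \<le> odds_root \<alpha>"
    using t_star_le_odds_root_iff(1)[of \<sigma> \<beta> \<alpha> \<mu> a] assms by simp
  then have peak: "tail_gain \<mu> \<sigma> a \<beta> p < tail_gain \<mu> \<sigma> a \<beta> \<alpha>"
    if "\<alpha> \<le> p" "p \<le> \<beta>" "p < 1" "p \<noteq> \<alpha>" for p
    using that assms by (intro tail_gain_strict_mono(2)) auto
  note max = two_level_unique_maximizer[of \<sigma> \<alpha> \<beta> \<alpha> a \<mu>, OF _ _ _ _ _ _ _ _ above peak]
  show "Psi_max \<mu> \<sigma> a \<alpha> \<beta> = ereal (Up \<mu> \<sigma> \<alpha> - a)"
    using max(1) assms by (simp add: tail_gain_def)
  show "is_unique_maximizer \<mu> \<sigma> a \<alpha> \<beta> (two_level \<mu> \<sigma> \<alpha>)"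
    using max(2) assms by simp
qed

text \<open>
  The first-order condition balances the loss in length against the gain in height, so the height
  \<open>U\<^sub>p - a\<close> at \<open>p\<^sup>*\<close> has the sign of \<open>\<beta> - p\<^sup>*\<close>.
\<close>

lemma Up_p_star_above:
  assumes "0 < \<sigma>" "0 < \<beta>" "\<beta> \<le> 1" "p_star \<mu> \<sigma> a \<beta> < \<beta>"
  shows "a < Up \<mu> \<sigma> (p_star \<mu> \<sigma> a \<beta>)"
proof -
  define t where "t = t_star \<mu> \<sigma> a \<beta>"
  have t: "0 < t" "quartic \<mu> \<sigma> a \<beta> t = 0"
    using t_star_root assms by (auto simp: t_def)
  have "0 < 1 + t\<^sup>2" by (smt (verit) zero_le_power2)
  moreover have "t\<^sup>2 / (1 + t\<^sup>2) < \<beta>"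
    using assms(4) by (simp add: p_star_def t_def)
  ultimately have less: "t\<^sup>2 < \<beta> * (1 + t\<^sup>2)"
    by (simp add: field_simps)
  have "\<sigma> * quartic \<mu> \<sigma> a \<beta> t
      = 2 * t * (\<mu> - a + \<sigma> * t) - \<sigma> * ((1 + t\<^sup>2) * (\<beta> * (1 + t\<^sup>2) - t\<^sup>2))"
  proof -
    have "\<sigma> * (2 * (\<mu> - a) / \<sigma>) = 2 * (\<mu> - a)"
      using assms by simp
    then show ?thesis unfolding quartic_def by algebra
  qed
  then have "2 * t * (\<mu> - a + \<sigma> * t) = \<sigma> * ((1 + t\<^sup>2) * (\<beta> * (1 + t\<^sup>2) - t\<^sup>2))"
    using t by simp
  also have "\<dots> > 0"
    using assms(1) less \<open>0 < 1 + t\<^sup>2\<close> by (intro mult_pos_pos) auto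
  finally have "0 < \<mu> - a + \<sigma> * t"
    using t by (simp add: zero_less_mult_iff)
  then show ?thesis
    using odds_root_p_star(3) assms by (simp add: Up_odds_root t_def)
qed

lemma Psi_max_between_thresholds:
  assumes "0 < \<sigma>" "0 \<le> \<alpha>" "\<alpha> < \<beta>" "\<beta> \<le> 1"
    and above: "0 < \<alpha> \<Longrightarrow> lower_threshold \<mu> \<sigma> \<alpha> \<beta> < a"
    and below: "\<beta> < 1 \<Longrightarrow> a < Up \<mu> \<sigma> \<beta>"
  shows "Psi_max \<mu> \<sigma> a \<alpha> \<beta> =
      ereal ((\<beta> - p_star \<mu> \<sigma> a \<beta>) / (\<beta> - \<alpha>) * (\<mu> - a + \<sigma> * t_star \<mu> \<sigma> a \<beta>))"
    and "is_unique_maximizer \<mu> \<sigma> a \<alpha> \<beta> (two_level \<mu> \<sigma> (p_star \<mu> \<sigma> a \<beta>))"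
proof -
  let ?p = "p_star \<mu> \<sigma> a \<beta>"
  have \<beta>: "0 < \<beta>" using assms by simp
  note p = odds_root_p_star[OF \<beta> assms(4), of \<mu> \<sigma> a]
  have "\<alpha> \<le> ?p"
  proof (rule ccontr)
    assume "\<not> \<alpha> \<le> ?p"
    then have *: "?p < \<alpha>" "0 < \<alpha>" "\<alpha> < 1" using p assms by auto
    then have "odds_root ?p < odds_root \<alpha>" using p by (intro odds_root_less) auto
    then show False
      using t_star_le_odds_root_iff(1)[of \<sigma> \<beta> \<alpha> \<mu> a] above * p assms \<beta> by simp
  qed
  have "?p < \<beta>"
  proof (rule ccontr)
    assume "\<not> ?p < \<beta>"
    then have *: "\<beta> \<le> ?p" "\<beta> < 1" using p by auto
    then have "odds_root \<beta> \<le> odds_root ?p"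
      using odds_root_less[of \<beta> ?p] p \<beta> by (cases "\<beta> = ?p") auto
    then show False
      using t_star_le_odds_root_iff(2)[of \<sigma> \<beta> \<beta> \<mu> a] lower_threshold_diagonal[of \<beta> \<mu> \<sigma>]
        below * p assms \<beta> by simp
  qed
  have above_a: "a < Up \<mu> \<sigma> ?p"
    using Up_p_star_above[OF assms(1) \<beta> assms(4)] \<open>?p < \<beta>\<close> by simp
  have peak: "tail_gain \<mu> \<sigma> a \<beta> r < tail_gain \<mu> \<sigma> a \<beta> ?p"
    if r: "\<alpha> \<le> r" "r \<le> \<beta>" "r < 1" "r \<noteq> ?p" for r
  proof (cases "r < ?p")
    case True
    then show ?thesis
      using r p assms \<beta> by (intro tail_gain_strict_mono(1)) auto
  next
    case False
    then show ?thesis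
      using r p assms \<beta> by (intro tail_gain_strict_mono(2)) auto
  qed
  note max = two_level_unique_maximizer[OF assms(1-4) p(1,2) \<open>\<alpha> \<le> ?p\<close> \<open>?p < \<beta>\<close> above_a peak]
  show "Psi_max \<mu> \<sigma> a \<alpha> \<beta> =
      ereal ((\<beta> - ?p) / (\<beta> - \<alpha>) * (\<mu> - a + \<sigma> * t_star \<mu> \<sigma> a \<beta>))"
    using max(1) p(3) by (simp add: tail_gain_def Up_odds_root algebra_simps)
  show "is_unique_maximizer \<mu> \<sigma> a \<alpha> \<beta> (two_level \<mu> \<sigma> ?p)"
    by (rule max(2))
qed

section \<open>The expectation case and the Scarf bound\<close>

lemma Psi_expectation:
  assumes "q \<in> L2_unit"
  shows "Psi a 0 1 q = (\<integral>x. stop_loss a x \<partial>law q)"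
proof -
  have "(\<integral>x. stop_loss a x \<partial>law q) = (\<integral>u. stop_loss a (q u) \<partial>unit_leb)"
    unfolding law_def using assms by (intro integral_distr) (auto simp: L2_unit_def stop_loss_def)
  then show ?thesis
    by (simp add: Psi_eq_slice slice_unit)
qed

text \<open>
  The numerator of \<open>T\<close> tends to \<open>- 1\<close> and its positive denominator to \<open>0\<close>.
\<close>

lemma T_ext_tendsto_MInfty:
  assumes "0 < \<sigma>"
  shows "((\<lambda>(\<alpha>, \<beta>). T_ext \<mu> \<sigma> \<alpha> \<beta>) \<longlongrightarrow> - \<infinity>) (at_right 0 \<times>\<^sub>F at_left 1)"
proof -
  let ?F = "at_right 0 \<times>\<^sub>F at_left (1 :: real) :: (real \<times> real) filter"
  let ?N = "\<lambda>x :: real \<times> real. - 2 * (fst x)\<^sup>2 + 3 * fst x - snd x"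
  let ?D = "\<lambda>x :: real \<times> real. 2 * (1 - fst x) * sqrt (fst x * (1 - fst x))"
  have fst: "(fst \<longlongrightarrow> 0) ?F"
    using filterlim_fst filterlim_at by blast
  have snd: "(snd \<longlongrightarrow> 1) ?F"
    using filterlim_snd filterlim_at by blast
  have "\<forall>\<^sub>F \<alpha> in at_right (0 :: real). 0 < \<alpha> \<and> \<alpha> < 1"
    by (rule eventually_at_rightI[of 0 1]) auto
  then have fst_small: "\<forall>\<^sub>F x in ?F. 0 < fst x \<and> fst x < 1"
    by (rule eventually_compose_filterlim[OF _ filterlim_fst])
  have "(?N \<longlongrightarrow> - 2 * 0\<^sup>2 + 3 * 0 - 1) ?F"
    by (intro tendsto_intros fst snd)
  then have N: "(?N \<longlongrightarrow> - 1) ?F" by simp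
  have "(?D \<longlongrightarrow> 2 * (1 - 0) * sqrt (0 * (1 - 0))) ?F"
    by (intro tendsto_intros fst snd)
  then have "filterlim ?D (at_right 0) ?F"
    unfolding filterlim_at using fst_small by (auto elim!: eventually_mono)
  then have "filterlim (\<lambda>x. inverse (?D x)) at_top ?F"
    by (rule filterlim_compose[OF filterlim_inverse_at_top_right])
  then have "filterlim (\<lambda>x. ?N x * inverse (?D x)) at_bot ?F"
    by (intro filterlim_tendsto_neg_mult_at_bot[OF N]) auto
  then have "filterlim (\<lambda>x. \<sigma> * (?N x * inverse (?D x))) at_bot ?F"
    by (rule filterlim_tendsto_pos_mult_at_bot[OF tendsto_const assms])
  then have "filterlim (\<lambda>x. \<mu> + \<sigma> * (?N x * inverse (?D x))) at_bot ?F"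
    by (rule filterlim_tendsto_add_at_bot_iff[OF tendsto_const, THEN iffD2])
  then have bot: "filterlim (\<lambda>x. lower_threshold \<mu> \<sigma> (fst x) (snd x)) at_bot ?F"
    by (simp add: lower_threshold_def divide_inverse)
  show ?thesis
    unfolding tendsto_MInfty
  proof
    fix r :: real
    have "\<forall>\<^sub>F x in ?F. lower_threshold \<mu> \<sigma> (fst x) (snd x) < r"
      using bot by (simp add: filterlim_at_bot_dense)
    then show "\<forall>\<^sub>F x in ?F. (case x of (\<alpha>, \<beta>) \<Rightarrow> T_ext \<mu> \<sigma> \<alpha> \<beta>) < ereal r"
      by eventually_elim (auto simp: T_ext_eq_lower_threshold)
  qed
qed

lemma Up_ext_tendsto_PInfty:
  assumes "0 < \<sigma>"
  shows "((\<lambda>\<beta>. Up_ext \<mu> \<sigma> \<beta>) \<longlongrightarrow> \<infinity>) (at_left 1)"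
  unfolding tendsto_PInfty
proof
  fix r :: real
  have "filterlim (\<lambda>\<beta>. \<mu> + \<sigma> * sqrt (\<beta> / (1 - \<beta>))) at_top (at_left 1)"
    using assms by real_asymp
  then have "\<forall>\<^sub>F \<beta> in at_left 1. r < \<mu> + \<sigma> * sqrt (\<beta> / (1 - \<beta>))"
    by (simp add: filterlim_at_top_dense)
  then show "\<forall>\<^sub>F \<beta> in at_left 1. ereal r < Up_ext \<mu> \<sigma> \<beta>"
    by eventually_elim (auto simp: Up_ext_def Up_def)
qed

text \<open>
  The coefficient of \<open>t ^ 4\<close> vanishes at \<open>\<beta> = 1\<close>, and the quadratic has the root
  \<open>(R - (\<mu> - a)) / \<sigma>\<close>. Everything else follows from
  \<open>(R - (\<mu> - a)) (R + (\<mu> - a)) = \<sigma>\<^sup>2\<close>; the jump level comes from the mean of the two-level quantile.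
\<close>

lemma scarf:
  fixes \<mu> \<sigma> a :: real
  assumes "0 < \<sigma>"
  defines "R \<equiv> sqrt ((\<mu> - a)\<^sup>2 + \<sigma>\<^sup>2)" and "p \<equiv> p_star \<mu> \<sigma> a 1"
  shows "t_star \<mu> \<sigma> a 1 = (R - (\<mu> - a)) / \<sigma>"
    and "Psi_max \<mu> \<sigma> a 0 1 = ereal (1 / 2 * (R - (a - \<mu>)))"
    and "Lo \<mu> \<sigma> p = a - R" "Up \<mu> \<sigma> p = a + R"
    and "is_unique_maximizer \<mu> \<sigma> a 0 1 (two_point p (a - R) (a + R))"
proof -
  define m where "m = \<mu> - a"
  define t where "t = (R - m) / \<sigma>"
  have Rsq: "R\<^sup>2 = m\<^sup>2 + \<sigma>\<^sup>2" by (simp add: R_def m_def)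
  have "\<bar>m\<bar> < R"
    unfolding R_def m_def[symmetric] using assms(1)
    by (metis less_add_same_cancel1 real_sqrt_abs real_sqrt_less_mono zero_less_power)
  then have R: "0 < R - m" "0 < R + m" "0 < R" by auto
  have st: "\<sigma> * t = R - m" using assms(1) by (simp add: t_def)
  have t: "0 < t" using R assms(1) by (simp add: t_def)
  have prod: "(R - m) * (R + m) = \<sigma>\<^sup>2"
    using Rsq by (simp add: algebra_simps power2_eq_square)
  have root: "quartic \<mu> \<sigma> a 1 t = 0"
  proof -
    have "\<sigma>\<^sup>2 * quartic \<mu> \<sigma> a 1 t = (\<sigma> * t)\<^sup>2 + 2 * m * (\<sigma> * t) - \<sigma>\<^sup>2"
      using assms(1) by (simp add: quartic_def m_def field_simps power2_eq_square)
    also have "\<dots> = 0"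
      unfolding st using Rsq by algebra
    finally show ?thesis using assms(1) by simp
  qed
  show t_star: "t_star \<mu> \<sigma> a 1 = (R - (\<mu> - a)) / \<sigma>"
    using t_star_eqI[OF _ _ t root] by (simp add: t_def m_def)
  then have t_star_t: "t_star \<mu> \<sigma> a 1 = t" by (simp add: t_def m_def)
  note props = odds_root_p_star[of 1 \<mu> \<sigma> a, simplified, folded p_def]
  have odds: "odds_root p = t" using props t_star_t by simp
  show U: "Up \<mu> \<sigma> p = a + R"
    unfolding Up_odds_root odds st by (simp add: m_def)
  show L: "Lo \<mu> \<sigma> p = a - R"
  proof -
    have "Lo \<mu> \<sigma> p = \<mu> - \<sigma> / t"
      by (simp add: Lo_def odds[symmetric] odds_root_def real_sqrt_divide)
    also have "\<sigma> / t = R + m"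
      using prod R assms(1) by (simp add: t_def field_simps power2_eq_square)
    finally show ?thesis by (simp add: m_def)
  qed
  have p: "1 - p = (R + m) / (2 * R)"
  proof -
    have "p * (a - R) + (1 - p) * (a + R) = \<mu>"
      using two_level_moments(1)[of p \<mu> \<sigma>] props U L by simp
    then show ?thesis using R by (simp add: m_def field_simps)
  qed
  note max = Psi_max_between_thresholds[of \<sigma> 0 1 \<mu> a, simplified, OF assms(1), folded p_def]
  show "Psi_max \<mu> \<sigma> a 0 1 = ereal (1 / 2 * (R - (a - \<mu>)))"
  proof -
    have "(1 - p) * (\<mu> - a + \<sigma> * t) = 1 / 2 * (R - (a - \<mu>))"
      unfolding p st m_def[symmetric] using R by (simp add: m_def)
    then show ?thesis using max(1) t_star_t by simp
  qed
  show "is_unique_maximizer \<mu> \<sigma> a 0 1 (two_point p (a - R) (a + R))"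
    using max(2) by (simp add: two_level_def U L)
qed
theorem proposition4:
  fixes \<mu> \<sigma> a \<alpha> \<beta> :: real
  assumes "\<sigma> > 0" and "0 \<le> \<alpha>" and "\<alpha> < \<beta>" and "\<beta> \<le> 1"
  shows
    "(Psi_min \<mu> \<sigma> a \<alpha> \<beta> = ereal (max (Lo \<mu> \<sigma> \<beta> - a) 0)
      \<and> (\<beta> < 1 \<longrightarrow> is_minimizer \<mu> \<sigma> a \<alpha> \<beta> (two_level \<mu> \<sigma> \<beta>)))
   \<and> (T_ext \<mu> \<sigma> \<alpha> \<beta> \<le> Up_ext \<mu> \<sigma> \<alpha> \<and> Up_ext \<mu> \<sigma> \<alpha> < Up_ext \<mu> \<sigma> \<beta>
      \<and> (ereal a \<le> T_ext \<mu> \<sigma> \<alpha> \<beta> \<longrightarrow>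
           Psi_max \<mu> \<sigma> a \<alpha> \<beta> = ereal (Up \<mu> \<sigma> \<alpha> - a)
         \<and> is_unique_maximizer \<mu> \<sigma> a \<alpha> \<beta> (two_level \<mu> \<sigma> \<alpha>))
      \<and> (T_ext \<mu> \<sigma> \<alpha> \<beta> < ereal a \<and> ereal a < Up_ext \<mu> \<sigma> \<beta> \<longrightarrow>
           (\<exists>!t. 0 < t \<and> quartic \<mu> \<sigma> a \<beta> t = 0)
         \<and> Psi_max \<mu> \<sigma> a \<alpha> \<beta> =
             ereal ((\<beta> - p_star \<mu> \<sigma> a \<beta>) / (\<beta> - \<alpha>) * (\<mu> - a + \<sigma> * t_star \<mu> \<sigma> a \<beta>))
         \<and> is_unique_maximizer \<mu> \<sigma> a \<alpha> \<beta> (two_level \<mu> \<sigma> (p_star \<mu> \<sigma> a \<beta>)))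
      \<and> (Up_ext \<mu> \<sigma> \<beta> \<le> ereal a \<longrightarrow>
           Psi_max \<mu> \<sigma> a \<alpha> \<beta> = 0
         \<and> is_maximizer \<mu> \<sigma> a \<alpha> \<beta> (two_level \<mu> \<sigma> \<beta>)))
   \<and> ((\<forall>u\<in>{0<..1}. rvar_weight 0 1 u = 1)
      \<and> (\<forall>q\<in>K_set \<inter> M_set \<mu> \<sigma>. Psi a 0 1 q = (\<integral>x. stop_loss a x \<partial>law q))
      \<and> ((\<lambda>(\<alpha>', \<beta>'). T_ext \<mu> \<sigma> \<alpha>' \<beta>') \<longlongrightarrow> - \<infinity>) (at_right 0 \<times>\<^sub>F at_left 1)
      \<and> ((\<lambda>\<beta>'. Up_ext \<mu> \<sigma> \<beta>') \<longlongrightarrow> \<infinity>) (at_left 1)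
      \<and> (\<forall>t. quartic \<mu> \<sigma> a 1 t = t\<^sup>2 + (2 * (\<mu> - a) / \<sigma>) * t - 1)
      \<and> t_star \<mu> \<sigma> a 1 = (sqrt ((\<mu> - a)\<^sup>2 + \<sigma>\<^sup>2) - (\<mu> - a)) / \<sigma>
      \<and> Psi_max \<mu> \<sigma> a 0 1 = ereal (1 / 2 * (sqrt ((a - \<mu>)\<^sup>2 + \<sigma>\<^sup>2) - (a - \<mu>)))
      \<and> Lo \<mu> \<sigma> (p_star \<mu> \<sigma> a 1) = a - sqrt ((\<mu> - a)\<^sup>2 + \<sigma>\<^sup>2)
      \<and> Up \<mu> \<sigma> (p_star \<mu> \<sigma> a 1) = a + sqrt ((\<mu> - a)\<^sup>2 + \<sigma>\<^sup>2)
      \<and> is_unique_maximizer \<mu> \<sigma> a 0 1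
          (two_point (p_star \<mu> \<sigma> a 1)
             (a - sqrt ((\<mu> - a)\<^sup>2 + \<sigma>\<^sup>2)) (a + sqrt ((\<mu> - a)\<^sup>2 + \<sigma>\<^sup>2))))"
proof (intro conjI)
  show "Psi_min \<mu> \<sigma> a \<alpha> \<beta> = ereal (max (Lo \<mu> \<sigma> \<beta> - a) 0)"
    using Psi_min_attained(1)[OF assms(1-3)] Psi_min_upper_level_one[of \<sigma> \<alpha> \<mu> a] assms
    by (cases "\<beta> = 1") auto
  show "\<beta> < 1 \<longrightarrow> is_minimizer \<mu> \<sigma> a \<alpha> \<beta> (two_level \<mu> \<sigma> \<beta>)"
    using Psi_min_attained(2)[OF assms(1-3)] by simp
  show "T_ext \<mu> \<sigma> \<alpha> \<beta> \<le> Up_ext \<mu> \<sigma> \<alpha>" "Up_ext \<mu> \<sigma> \<alpha> < Up_ext \<mu> \<sigma> \<beta>"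
    using regime_boundaries_ordered[OF assms] by auto
  show "ereal a \<le> T_ext \<mu> \<sigma> \<alpha> \<beta> \<longrightarrow>
           Psi_max \<mu> \<sigma> a \<alpha> \<beta> = ereal (Up \<mu> \<sigma> \<alpha> - a)
         \<and> is_unique_maximizer \<mu> \<sigma> a \<alpha> \<beta> (two_level \<mu> \<sigma> \<alpha>)"
    using Psi_max_below_lower_threshold[OF assms(1) _ assms(3,4), of a \<mu>] assms(2)
    by (auto simp: T_ext_eq_lower_threshold split: if_splits)
  show "T_ext \<mu> \<sigma> \<alpha> \<beta> < ereal a \<and> ereal a < Up_ext \<mu> \<sigma> \<beta> \<longrightarrow>
           (\<exists>!t. 0 < t \<and> quartic \<mu> \<sigma> a \<beta> t = 0)
         \<and> Psi_max \<mu> \<sigma> a \<alpha> \<beta> =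
             ereal ((\<beta> - p_star \<mu> \<sigma> a \<beta>) / (\<beta> - \<alpha>) * (\<mu> - a + \<sigma> * t_star \<mu> \<sigma> a \<beta>))
         \<and> is_unique_maximizer \<mu> \<sigma> a \<alpha> \<beta> (two_level \<mu> \<sigma> (p_star \<mu> \<sigma> a \<beta>))"
  proof
    assume regime: "T_ext \<mu> \<sigma> \<alpha> \<beta> < ereal a \<and> ereal a < Up_ext \<mu> \<sigma> \<beta>"
    then have "0 < \<alpha> \<Longrightarrow> lower_threshold \<mu> \<sigma> \<alpha> \<beta> < a" "\<beta> < 1 \<Longrightarrow> a < Up \<mu> \<sigma> \<beta>"
      by (auto simp: T_ext_eq_lower_threshold Up_ext_def)
    from Psi_max_between_thresholds[OF assms this] quartic_unique_root[of \<beta> \<mu> \<sigma> a] assms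
    show "(\<exists>!t. 0 < t \<and> quartic \<mu> \<sigma> a \<beta> t = 0)
         \<and> Psi_max \<mu> \<sigma> a \<alpha> \<beta> =
             ereal ((\<beta> - p_star \<mu> \<sigma> a \<beta>) / (\<beta> - \<alpha>) * (\<mu> - a + \<sigma> * t_star \<mu> \<sigma> a \<beta>))
         \<and> is_unique_maximizer \<mu> \<sigma> a \<alpha> \<beta> (two_level \<mu> \<sigma> (p_star \<mu> \<sigma> a \<beta>))"
      by (intro conjI) simp_all
  qed
  show "Up_ext \<mu> \<sigma> \<beta> \<le> ereal a \<longrightarrow>
           Psi_max \<mu> \<sigma> a \<alpha> \<beta> = 0
         \<and> is_maximizer \<mu> \<sigma> a \<alpha> \<beta> (two_level \<mu> \<sigma> \<beta>)"
    using Psi_max_above_Up[OF assms(1-3), of \<mu> a] assms(4)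
    by (auto simp: Up_ext_def split: if_splits)
  show "\<forall>u\<in>{0<..1}. rvar_weight 0 1 u = 1"
    by (simp add: rvar_weight_def)
  show "\<forall>q\<in>K_set \<inter> M_set \<mu> \<sigma>. Psi a 0 1 q = (\<integral>x. stop_loss a x \<partial>law q)"
    using Psi_expectation by (auto simp: K_set_def)
  show "((\<lambda>(\<alpha>', \<beta>'). T_ext \<mu> \<sigma> \<alpha>' \<beta>') \<longlongrightarrow> - \<infinity>) (at_right 0 \<times>\<^sub>F at_left 1)"
    by (rule T_ext_tendsto_MInfty[OF assms(1)])
  show "((\<lambda>\<beta>'. Up_ext \<mu> \<sigma> \<beta>') \<longlongrightarrow> \<infinity>) (at_left 1)"
    by (rule Up_ext_tendsto_PInfty[OF assms(1)])
  show "\<forall>t. quartic \<mu> \<sigma> a 1 t = t\<^sup>2 + (2 * (\<mu> - a) / \<sigma>) * t - 1"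
    by (simp add: quartic_def)
  show "Psi_max \<mu> \<sigma> a 0 1 = ereal (1 / 2 * (sqrt ((a - \<mu>)\<^sup>2 + \<sigma>\<^sup>2) - (a - \<mu>)))"
    using scarf(2)[OF assms(1), of \<mu> a] by (simp only: power2_commute)
qed (rule scarf[OF assms(1)])+

end
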